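(* Let $G_n$ be a sequence of finite and connected graphs with all vertex degrees at most $\Delta$. Let $\mu^{\mathrm{SRW}}_{G_n}$ denote the empirical measure of the eigenvalues of the Markov operator of $G_n$, that is, of the matrix $P$ with entries $P(x,y)=\frac{1}{\deg x}\mathbf{1}_{\{x\sim y\}}$ for $x,y\in V(G_n)$. Suppose $|G_n|\to\infty$ and $|G_n^{\mathrm{core}}|/|G_n|\to1$. Then for every $\epsilon>0$, $$\liminf_{n\to\infty}\ \mu^{\mathrm{SRW}}_{G_n}\left(\left\{x:\ |x|>\frac{2\sqrt{d_{\mathrm{av}}(G_n)-1}}{\frac{1}{2|E(G_n)|}\sum_{v\in V(G_n)}(\deg v)^2}-\epsilon\right\}\right)>0.$$
   Context: Graphs are simple and undirected. $|G|$ is the number of vertices, $E(G)$ the edge set, and $d_{\mathrm{av}}(G)=2|E(G)|/|G|$ the average degree. $x\sim y$ means that $x$ and $y$ are adjacent. The empirical measure of the eigenvalues of an $N\times N$ matrix gives mass $1/N$ to each eigenvalue, counted with multiplicity. For a finite connected graph $G$, its 2-core $G^{\mathrm{core}}$ is the subgraph obtained by iteratively removing leaves (degree-one vertices) from $G$ until none remains; if $G$ has no leaves then $G^{\mathrm{core}}=G$, and if $G$ is a tree then $G^{\mathrm{core}}$ is empty by convention. *)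

theory Defs
  imports
    "HOL-Probability.Probability"
    "HOL-Computational_Algebra.Computational_Algebra"
    "HOL-Library.While_Combinator"
    "Jordan_Normal_Form.Char_Poly"
    "Graph_Theory.Graph_Theory"
begin

text \<open>
  Finite simple undirected graphs are the locale \<^locale>\<open>graph\<close>, in which an edge between
  \<open>x\<close> and \<open>y\<close> is a pair of opposite arcs.  Hence \<^const>\<open>out_degree\<close> is the
  degree, and \<open>edges\<close> below counts each undirected edge once.
\<close>

definition edges :: "('a, 'b) pre_digraph \<Rightarrow> 'a set set" where
  "edges G = (\<lambda>e. {tail G e, head G e}) ` arcs G"

definition avg_degree :: "('a, 'b) pre_digraph \<Rightarrow> real" where
  "avg_degree G = 2 * real (card (edges G)) / real (card (verts G))"


text \<open>
  The library predicate \<open>tree\<close> is not usable here: it is stated for digraphs, where an edge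
  traversed back and forth is a cycle.  In a simple graph a cycle has length at least 3.
\<close>

definition undirected_tree :: "('a, 'b) pre_digraph \<Rightarrow> bool" where
  "undirected_tree G \<longleftrightarrow>
     Digraph_Component.connected G \<and> \<not> (\<exists>p. pre_digraph.cycle G p \<and> 3 \<le> length p)"

definition leaves :: "('a, 'b) pre_digraph \<Rightarrow> 'a set" where
  "leaves G = {v \<in> verts G. out_degree G v = 1}"

text \<open>
  Each round removes all current leaves at once.  In a connected graph that is not a tree no two
  leaves are adjacent, so this gives the same result as removing them one at a time in any order.
\<close>

definition two_core :: "('a, 'b) pre_digraph \<Rightarrow> ('a, 'b) pre_digraph" where
  "two_core G =
     (if undirected_tree G then G \<restriction> {}
      else while (\<lambda>H. leaves H \<noteq> {}) (\<lambda>H. H \<restriction> (verts H - leaves H)) G)"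

lemma leaves_two_core:
  assumes "finite (verts G)"
  shows "leaves (two_core G) = {}"
proof (cases "undirected_tree G")
  case True
  then show ?thesis by (simp add: two_core_def leaves_def)
next
  case False
  have "leaves (while (\<lambda>H. leaves H \<noteq> {}) (\<lambda>H. H \<restriction> (verts H - leaves H)) G) = {}"
  proof (rule while_rule[where P = "\<lambda>H. finite (verts H)"
        and r = "Wellfounded.measure (\<lambda>H. card (verts H))"])
    fix H :: "('a, 'b) pre_digraph"
    assume H: "finite (verts H)" "leaves H \<noteq> {}"
    then have "verts H - leaves H \<subset> verts H" by (auto simp: leaves_def)
    with H show "(H \<restriction> (verts H - leaves H), H) \<in> Wellfounded.measure (\<lambda>H. card (verts H))"
      by (simp add: psubset_card_mono)
  qed (use assms in auto)
  with False show ?thesis by (simp add: two_core_def)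
qed


definition markov_kernel :: "('a, 'b) pre_digraph \<Rightarrow> 'a \<Rightarrow> 'a \<Rightarrow> real" where
  "markov_kernel G x y = (if x \<rightarrow>\<^bsub>G\<^esub> y then 1 / real (out_degree G x) else 0)"

text \<open>
  Matrices are indexed by natural numbers, so the vertices are listed by \<^const>\<open>from_nat_into\<close>;
  another enumeration only conjugates the matrix by a permutation.
\<close>

definition markov_matrix :: "('a, 'b) pre_digraph \<Rightarrow> real mat" where
  "markov_matrix G = mat (card (verts G)) (card (verts G))
     (\<lambda>(i, j). markov_kernel G (from_nat_into (verts G) i) (from_nat_into (verts G) j))"

text \<open>
  The eigenvalues with algebraic multiplicity are the roots of the characteristic polynomial over
  the complex numbers.
\<close>

definition empirical_spectral_measure :: "complex mat \<Rightarrow> complex pmf" where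
  "empirical_spectral_measure A = pmf_of_multiset (proots (char_poly A))"

lemma pmf_empirical_spectral_measure:
  assumes A: "A \<in> carrier_mat N N" and N: "N > 0"
  shows "pmf (empirical_spectral_measure A) z = real (order z (char_poly A)) / real N"
proof -
  have deg: "degree (char_poly A) = N" and "monic (char_poly A)"
    using degree_monic_char_poly[OF A] by auto
  then have nz: "char_poly A \<noteq> 0" using N by auto
  have sz: "size (proots (char_poly A)) = N"
    using deg by (simp add: size_proots_complex)
  with N have "proots (char_poly A) \<noteq> {#}" by auto
  with sz nz show ?thesis by (simp add: empirical_spectral_measure_def)
qed

text \<open>
  The random walk is reversible, so all the mass lies on the real axis.
\<close>

definition srw_measure :: "('a, 'b) pre_digraph \<Rightarrow> complex pmf" where
  "srw_measure G = empirical_spectral_measure (map_mat complex_of_real (markov_matrix G))"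

end

theory Submission
  imports Defs "Jordan_Normal_Form.Schur_Decomposition"
begin

text \<open>
  Let \<open>Q\<close> be the normalised adjacency matrix with entries \<open>1 / sqrt (deg x * deg y)\<close>, which has the
  spectrum of the Markov operator.  The nonbacktracking walks with at most \<open>r + 1\<close> steps in the
  2-core form a forest, namely pieces of its universal cover.  The forest carries the operator \<open>M\<close> lifted
  from \<open>Q\<close> and the test function \<open>F = sqrt w\<close>, where \<open>w\<close> is the law of the nonbacktracking walk.
  Since the uniform measure on arcs is stationary for that walk, the Rayleigh quotient of \<open>F\<close> is
  \<open>2 r / (r + 1)\<close> times the mean over arcs \<open>(y, z)\<close> of \<open>sqrt ((deg\<^sub>c y - 1) / (deg y * deg z))\<close>,
  with \<open>deg\<^sub>c\<close> the degree in the core, and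
  Jensen's inequality bounds this mean below by the required quotient of averages.

  By Cauchy--Schwarz, \<open>M\<^sup>m\<close> has quotient at least the \<open>m\<close>-th power of this when \<open>m\<close> is a power
  of 2.  Entries of \<open>M\<^sup>m\<close> are dominated by those of \<open>Q\<^sup>m\<close>, whose off-diagonal entries are
  dominated by the diagonal, so the trace of \<open>Q\<^sup>m\<close> is at least a constant, depending only on \<open>r\<close>
  and the degree bound, times the number of vertices times that power.  For \<open>m\<close> large but fixed
  this is incompatible with too few eigenvalues exceeding the claimed radius by absolute value.
\<close>

section \<open>Powers of a kernel on a finite set\<close>

text \<open>Kernels on an arbitrary finite set let operators on vertices and operators on walks be
  handled alike, with no enumeration by numbers.\<close>

fun kpow :: "'a set \<Rightarrow> ('a \<Rightarrow> 'a \<Rightarrow> real) \<Rightarrow> nat \<Rightarrow> 'a \<Rightarrow> 'a \<Rightarrow> real" where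
  "kpow S K 0 x y = of_bool (x = y)"
| "kpow S K (Suc k) x y = (\<Sum>z\<in>S. K x z * kpow S K k z y)"

lemma kpow_1:
  assumes "finite S" "y \<in> S"
  shows "kpow S K (Suc 0) x y = K x y"
  using assms by (simp add: of_bool_def sum.delta if_distrib cong: if_cong)

lemma kpow_nonneg:
  assumes "\<And>x y. K x y \<ge> 0"
  shows "kpow S K k x y \<ge> 0"
  by (induction k arbitrary: x) (auto intro!: sum_nonneg mult_nonneg_nonneg assms)

lemma kpow_add:
  assumes "finite S" "x \<in> S"
  shows "kpow S K (m + n) x y = (\<Sum>z\<in>S. kpow S K m x z * kpow S K n z y)"
  using assms(2)
proof (induction m arbitrary: x)
  case 0
  have "(\<Sum>z\<in>S. of_bool (x = z) * kpow S K n z y) = (\<Sum>z\<in>S. if z = x then kpow S K n z y else 0)"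
    by (intro sum.cong) auto
  with 0 assms show ?case by simp
next
  case (Suc m)
  have "kpow S K (Suc m + n) x y = (\<Sum>z\<in>S. K x z * (\<Sum>w\<in>S. kpow S K m z w * kpow S K n w y))"
    using Suc.IH by simp
  also have "\<dots> = (\<Sum>w\<in>S. \<Sum>z\<in>S. K x z * (kpow S K m z w * kpow S K n w y))"
    by (subst sum.swap) (simp add: sum_distrib_left)
  also have "\<dots> = (\<Sum>w\<in>S. kpow S K (Suc m) x w * kpow S K n w y)"
    by (simp add: sum_distrib_right mult.assoc)
  finally show ?case .
qed

lemma kpow_commute:
  assumes "finite S" "\<And>x y. x \<in> S \<Longrightarrow> y \<in> S \<Longrightarrow> K x y = K y x" "x \<in> S" "y \<in> S"
  shows "kpow S K k x y = kpow S K k y x"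
  using assms(3,4)
proof (induction k arbitrary: x y)
  case (Suc k)
  have "kpow S K (Suc k) x y = (\<Sum>z\<in>S. kpow S K k y z * kpow S K (Suc 0) z x)"
    unfolding kpow.simps(2)[of S K k x y]
    by (intro sum.cong refl) (simp add: kpow_1 assms(1,2) Suc del: kpow.simps)
  also have "\<dots> = kpow S K (k + Suc 0) y x"
    by (rule kpow_add[OF assms(1) Suc.prems(2), symmetric])
  finally show ?case by simp
qed auto

text \<open>An entry of an even power of a symmetric kernel is the inner product of two rows of the
  half power, and \<open>a * b \<le> (a * a + b * b) / 2\<close> applies termwise.\<close>

lemma kpow_le_diagonal:
  assumes "finite S" "\<And>x y. x \<in> S \<Longrightarrow> y \<in> S \<Longrightarrow> K x y = K y x" "x \<in> S" "y \<in> S"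
  shows "kpow S K (k + k) x y \<le> (kpow S K (k + k) x x + kpow S K (k + k) y y) / 2"
proof -
  have eq: "kpow S K (k + k) u v = (\<Sum>z\<in>S. kpow S K k u z * kpow S K k v z)"
    if "u \<in> S" "v \<in> S" for u v
    using that kpow_add[OF assms(1) that(1)] kpow_commute[OF assms(1,2), where k = k]
    by (simp cong: sum.cong)
  have ab: "a * b \<le> (a * a + b * b) / 2" for a b :: real
    using sum_squares_bound[of a b] by (simp add: power2_eq_square)
  have "(\<Sum>z\<in>S. kpow S K k x z * kpow S K k y z)
      \<le> (\<Sum>z\<in>S. (kpow S K k x z * kpow S K k x z + kpow S K k y z * kpow S K k y z) / 2)"
    by (intro sum_mono ab)
  also have "\<dots> = ((\<Sum>z\<in>S. kpow S K k x z * kpow S K k x z)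
                  + (\<Sum>z\<in>S. kpow S K k y z * kpow S K k y z)) / 2"
    by (simp only: sum.distrib sum_divide_distrib[symmetric])
  finally show ?thesis using eq assms(3,4) by simp
qed

definition qform :: "'a set \<Rightarrow> ('a \<Rightarrow> 'a \<Rightarrow> real) \<Rightarrow> ('a \<Rightarrow> real) \<Rightarrow> real" where
  "qform S K f = (\<Sum>s\<in>S. \<Sum>t\<in>S. f s * K s t * f t)"

text \<open>By symmetry the form of a doubled power is the squared norm of the half power applied to
  \<open>f\<close>. It is thus nonnegative, and it is the quantity that Cauchy--Schwarz
  produces.\<close>

lemma qform_double:
  assumes "finite S" "\<And>x y. x \<in> S \<Longrightarrow> y \<in> S \<Longrightarrow> K x y = K y x"
  shows "qform S (kpow S K (k + k)) f = (\<Sum>z\<in>S. (\<Sum>s\<in>S. f s * kpow S K k s z)\<^sup>2)"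
proof -
  have "qform S (kpow S K (k + k)) f
      = (\<Sum>s\<in>S. \<Sum>t\<in>S. \<Sum>z\<in>S. (f s * kpow S K k s z) * (f t * kpow S K k t z))"
    unfolding qform_def
    using kpow_add[OF assms(1)] kpow_commute[OF assms, where k = k]
    by (auto simp: sum_distrib_left sum_distrib_right algebra_simps intro!: sum.cong)
  also have "\<dots> = (\<Sum>s\<in>S. \<Sum>z\<in>S. \<Sum>t\<in>S. (f s * kpow S K k s z) * (f t * kpow S K k t z))"
    by (intro sum.cong refl sum.swap)
  also have "\<dots> = (\<Sum>z\<in>S. \<Sum>s\<in>S. \<Sum>t\<in>S. (f s * kpow S K k s z) * (f t * kpow S K k t z))"
    by (rule sum.swap)
  finally show ?thesis by (simp add: power2_eq_square sum_product)
qed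

text \<open>Cauchy--Schwarz for \<open>f\<close> and its image under the \<open>n\<close>-th power:
  the lower bound for the Rayleigh quotient is squared whenever the exponent doubles. Here
  \<open>R \<ge> 0\<close> makes squaring monotone.\<close>

lemma qform_power2_ge:
  assumes "finite S" and sym: "\<And>x y. x \<in> S \<Longrightarrow> y \<in> S \<Longrightarrow> K x y = K y x"
    and "R \<ge> 0" and R: "R * (\<Sum>s\<in>S. (f s)\<^sup>2) \<le> qform S K f"
  shows "R ^ (2 ^ p) * (\<Sum>s\<in>S. (f s)\<^sup>2) \<le> qform S (kpow S K (2 ^ p)) f"
proof (induction p)
  case 0
  have "qform S (kpow S K (Suc 0)) f = qform S K f"
    unfolding qform_def by (intro sum.cong refl) (simp add: kpow_1 assms(1) del: kpow.simps)
  with R show ?case by (simp del: kpow.simps)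
next
  case (Suc p)
  define n where "n = (2::nat) ^ p"
  define N where "N = (\<Sum>s\<in>S. (f s)\<^sup>2)"
  have N: "N \<ge> 0" by (simp add: N_def sum_nonneg)
  have eq: "qform S (kpow S K n) f = (\<Sum>z\<in>S. (\<Sum>s\<in>S. f s * kpow S K n s z) * f z)"
    unfolding qform_def by (subst sum.swap) (simp add: sum_distrib_right)
  have dbl: "qform S (kpow S K (n + n)) f = (\<Sum>z\<in>S. (\<Sum>s\<in>S. f s * kpow S K n s z)\<^sup>2)"
    using assms(1) sym by (rule qform_double)
  have "(R ^ n * N)\<^sup>2 \<le> (qform S (kpow S K n) f)\<^sup>2"
    using Suc N \<open>R \<ge> 0\<close> by (intro power_mono) (auto simp: n_def N_def)
  also have "\<dots> \<le> qform S (kpow S K (n + n)) f * N"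
    unfolding eq dbl N_def by (rule Cauchy_Schwarz_ineq_sum)
  finally have *: "N * (R ^ (n + n) * N) \<le> N * qform S (kpow S K (n + n)) f"
    by (simp add: power2_eq_square power_add mult_ac)
  have "R ^ (n + n) * N \<le> qform S (kpow S K (n + n)) f"
  proof (cases "N = 0")
    \<comment> \<open>The factor \<open>N\<close> cannot be cancelled here, but the left side is 0
      and the right side is a sum of squares.\<close>
    case True
    then show ?thesis unfolding dbl by (simp add: sum_nonneg)
  next
    case False
    with N * show ?thesis by (simp add: mult_le_cancel_left)
  qed
  then show ?case by (simp add: n_def N_def mult_2)
qed

section \<open>Traces and eigenvalues\<close>

lemma upper_triangular_mult:
  fixes A B :: "'a :: comm_ring_1 mat"
  assumes A: "A \<in> carrier_mat n n" "upper_triangular A" and B: "B \<in> carrier_mat n n" "upper_triangular B"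
  shows "upper_triangular (A * B)" "\<And>i. i < n \<Longrightarrow> (A * B) $$ (i, i) = A $$ (i, i) * B $$ (i, i)"
proof -
  have entry: "(A * B) $$ (i, j) = (\<Sum>k\<in>{0..<n}. A $$ (i, k) * B $$ (k, j))" if "i < n" "j < n" for i j
    using that A(1) B(1) by (simp add: scalar_prod_def)
  have A0: "A $$ (i, j) = 0" if "j < i" "i < n" for i j using A that by (auto dest: upper_triangularD)
  have B0: "B $$ (i, j) = 0" if "j < i" "i < n" for i j using B that by (auto dest: upper_triangularD)
  show "upper_triangular (A * B)"
  proof (rule upper_triangularI)
    fix i j assume ij: "j < i" "i < dim_row (A * B)"
    then have i: "i < n" using A by simp
    have "A $$ (i, k) * B $$ (k, j) = 0" if "k < n" for k
      using A0[of k i] B0[of j k] ij i that by (cases "k < i") auto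
    then show "(A * B) $$ (i, j) = 0" using ij i by (simp add: entry)
  qed
  fix i assume i: "i < n"
  have "A $$ (i, k) * B $$ (k, i) = (if k = i then A $$ (i, i) * B $$ (i, i) else 0)" if "k < n" for k
    using A0[of k i] B0[of i k] i that by (cases k i rule: linorder_cases) auto
  then have "(A * B) $$ (i, i) = (\<Sum>k\<in>{0..<n}. if k = i then A $$ (i, i) * B $$ (i, i) else 0)"
    unfolding entry[OF i i] by (intro sum.cong) auto
  then show "(A * B) $$ (i, i) = A $$ (i, i) * B $$ (i, i)" using i by simp
qed

lemma upper_triangular_pow:
  fixes A :: "'a :: comm_ring_1 mat"
  assumes A: "A \<in> carrier_mat n n" "upper_triangular A"
  shows "upper_triangular (A ^\<^sub>m k)" "\<And>i. i < n \<Longrightarrow> (A ^\<^sub>m k) $$ (i, i) = (A $$ (i, i)) ^ k"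
proof -
  have "upper_triangular (A ^\<^sub>m k) \<and> (\<forall>i<n. (A ^\<^sub>m k) $$ (i, i) = (A $$ (i, i)) ^ k)"
  proof (induction k)
    case 0
    then show ?case using A by (auto intro!: upper_triangularI)
  next
    case (Suc k)
    have c: "A ^\<^sub>m k \<in> carrier_mat n n" using A by simp
    show ?case using upper_triangular_mult[OF c _ A] Suc by (simp add: mult.commute)
  qed
  then show "upper_triangular (A ^\<^sub>m k)" "\<And>i. i < n \<Longrightarrow> (A ^\<^sub>m k) $$ (i, i) = (A $$ (i, i)) ^ k"
    by auto
qed

definition mat_trace :: "'a :: comm_ring_1 mat \<Rightarrow> 'a" where
  "mat_trace A = (\<Sum>i<dim_row A. A $$ (i, i))"

lemma mat_trace_mult_commute:
  assumes "A \<in> carrier_mat n m" "B \<in> carrier_mat m n"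
  shows "mat_trace (A * B) = mat_trace (B * A)"
proof -
  have "mat_trace (A * B) = (\<Sum>i<n. \<Sum>k<m. A $$ (i, k) * B $$ (k, i))"
    using assms by (simp add: mat_trace_def scalar_prod_def lessThan_atLeast0)
  also have "\<dots> = (\<Sum>k<m. \<Sum>i<n. A $$ (i, k) * B $$ (k, i))" by (rule sum.swap)
  also have "\<dots> = mat_trace (B * A)"
    using assms by (simp add: mat_trace_def scalar_prod_def lessThan_atLeast0 mult.commute)
  finally show ?thesis .
qed

lemma proots_prod_linear_factors:
  "proots (\<Prod>a\<leftarrow>es. [:- a, 1:]) = mset (es :: 'a :: idom list)"
proof (induction es)
  case (Cons a es)
  have "(\<Prod>a\<leftarrow>es. [:- a, 1:]) \<noteq> 0" by (auto simp: prod_list_zero_iff)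
  then have "proots ([:- a, 1:] * (\<Prod>a\<leftarrow>es. [:- a, 1:]))
      = proots [:- a, 1:] + proots (\<Prod>a\<leftarrow>es. [:- a, 1:])"
    by (intro proots_mult) auto
  with Cons show ?case by (simp del: mult_pCons_left)
qed simp

text \<open>Schur triangularisation: conjugation preserves the trace, and the diagonal of a power of
  a triangular matrix consists of powers of the eigenvalues. The multiset \<open>proots\<close>
  carries the multiplicities, as in the spectral measure.\<close>

lemma mat_trace_pow_eq_sum_eigenvalues:
  fixes A :: "complex mat"
  assumes A: "A \<in> carrier_mat n n"
  shows "mat_trace (A ^\<^sub>m k) = (\<Sum>z\<in>#proots (char_poly A). z ^ k)"
proof -
  from char_poly_factorized[OF A] obtain es where
    es: "char_poly A = (\<Prod>a\<leftarrow>es. [:- a, 1:])" by auto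
  obtain B P Q where "schur_decomposition A es = (B, P, Q)" by (cases "schur_decomposition A es") auto
  from schur_decomposition[OF A es this] have sim: "similar_mat_wit A B P Q"
    and ut: "upper_triangular B" and diag: "diag_mat B = es" by auto
  from similar_mat_witD2[OF A sim] have B: "B \<in> carrier_mat n n" and P: "P \<in> carrier_mat n n"
    and Q: "Q \<in> carrier_mat n n" and QP: "Q * P = 1\<^sub>m n" by auto
  have Bk: "B ^\<^sub>m k \<in> carrier_mat n n" using B by simp
  have "mat_trace (A ^\<^sub>m k) = mat_trace ((P * B ^\<^sub>m k) * Q)" using similar_mat_wit_pow_id[OF sim] by simp
  also have "\<dots> = mat_trace (Q * (P * B ^\<^sub>m k))" using P Q Bk by (intro mat_trace_mult_commute) auto
  also have "Q * (P * B ^\<^sub>m k) = Q * P * B ^\<^sub>m k" using P Q Bk by (simp add: assoc_mult_mat)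
  also have "\<dots> = B ^\<^sub>m k" by (simp only: QP left_mult_one_mat[OF Bk])
  also have "mat_trace (B ^\<^sub>m k) = (\<Sum>i<n. (B $$ (i, i)) ^ k)"
    using B upper_triangular_pow[OF B ut] by (simp add: mat_trace_def)
  also have "\<dots> = sum_list (map (\<lambda>z. z ^ k) es)"
    unfolding diag[symmetric] diag_mat_def using B
    by (simp add: sum_list_sum_nth lessThan_atLeast0)
  also have "\<dots> = (\<Sum>z\<in>#mset es. z ^ k)" by (metis mset_map sum_mset_sum_list)
  also have "mset es = proots (char_poly A)" by (simp only: es proots_prod_linear_factors)
  finally show ?thesis .
qed

lemma measure_pmf_of_multiset:
  assumes "M \<noteq> {#}"
  shows "measure_pmf.prob (pmf_of_multiset M) X = real (size (filter_mset (\<lambda>x. x \<in> X) M)) / real (size M)"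
proof -
  have "measure_pmf.prob (pmf_of_multiset M) X = measure_pmf.prob (pmf_of_multiset M) (X \<inter> set_mset M)"
    using assms by (metis measure_Int_set_pmf set_pmf_of_multiset)
  also have "\<dots> = (\<Sum>x\<in>X \<inter> set_mset M. real (count M x) / real (size M))"
    using assms by (subst measure_measure_pmf_finite) auto
  also have "\<dots> = real (\<Sum>x\<in>X \<inter> set_mset M. count M x) / real (size M)"
    by (simp add: sum_divide_distrib)
  also have "(\<Sum>x\<in>X \<inter> set_mset M. count M x) = size (filter_mset (\<lambda>x. x \<in> X) M)"
    unfolding size_multiset_overloaded_eq by (rule sum.cong) auto
  finally show ?thesis .
qed

text \<open>An eigenvalue of modulus above \<open>t\<close> contributes at most 1 to the power sum
  and any other at most \<open>t ^ k\<close>. A large trace therefore forces many eigenvalues above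
  \<open>t\<close>.\<close>

lemma mat_trace_pow_le_spectral_measure:
  fixes A :: "complex mat"
  assumes A: "A \<in> carrier_mat n n" and n: "n > 0" and "t \<ge> 0"
    and le1: "\<And>z. eigenvalue A z \<Longrightarrow> cmod z \<le> 1"
  shows "cmod (mat_trace (A ^\<^sub>m k)) \<le>
    real n * (measure_pmf.prob (empirical_spectral_measure A) {z. cmod z > t} + t ^ k)"
proof -
  define M where "M = proots (char_poly A)"
  have deg: "degree (char_poly A) = n" and mon: "monic (char_poly A)"
    using degree_monic_char_poly[OF A] by auto
  then have nz: "char_poly A \<noteq> 0" using n by auto
  have sz: "size M = n" using deg by (simp add: M_def size_proots_complex)
  with n have M: "M \<noteq> {#}" by auto
  have bound: "cmod z ^ k \<le> of_bool (cmod z > t) + t ^ k" if "z \<in># M" for z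
  proof (cases "cmod z > t")
    case True
    have "eigenvalue A z" using that nz by (simp add: M_def eigenvalue_root_char_poly[OF A])
    then have "cmod z ^ k \<le> 1" using le1 by (intro power_le_one) auto
    then show ?thesis using True \<open>t \<ge> 0\<close> by (simp add: add_increasing2)
  next
    case False
    then show ?thesis by (simp add: power_mono)
  qed
  have "cmod (mat_trace (A ^\<^sub>m k)) \<le> (\<Sum>z\<in>#M. cmod z ^ k)"
  proof -
    have "cmod (\<Sum>z\<in>#N. z ^ k) \<le> (\<Sum>z\<in>#N. cmod z ^ k)" for N :: "complex multiset"
      by (induction N) (auto simp: norm_power intro: norm_triangle_le)
    then show ?thesis by (simp add: mat_trace_pow_eq_sum_eigenvalues[OF A] M_def)
  qed
  also have "\<dots> \<le> (\<Sum>z\<in>#M. of_bool (cmod z > t) + t ^ k)"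
    using bound by (intro sum_mset_mono) auto
  also have "\<dots> = real (size (filter_mset (\<lambda>z. cmod z > t) M)) + real (size M) * t ^ k"
    by (induction M) (auto simp: algebra_simps)
  also have "\<dots> = real n * (measure_pmf.prob (pmf_of_multiset M) {z. cmod z > t} + t ^ k)"
    using n sz by (simp add: measure_pmf_of_multiset[OF M] algebra_simps)
  finally show ?thesis by (simp add: empirical_spectral_measure_def M_def)
qed

text \<open>Maximum principle: the eigenvector equation is read at a coordinate of largest
  modulus.\<close>

lemma eigenvalue_stochastic_le_1:
  fixes A :: "complex mat"
  assumes A: "A \<in> carrier_mat n n" and "eigenvalue A z"
    and row: "\<And>i. i < n \<Longrightarrow> (\<Sum>j<n. cmod (A $$ (i, j))) \<le> 1"
  shows "cmod z \<le> 1"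
proof -
  from assms obtain v where v: "v \<in> carrier_vec n" "v \<noteq> 0\<^sub>v n" "A *\<^sub>v v = z \<cdot>\<^sub>v v"
    by (auto simp: eigenvalue_def eigenvector_def)
  then obtain i0 where i0: "i0 < n" "v $ i0 \<noteq> 0" by (metis carrier_vecD eq_vecI index_zero_vec)
  define m where "m = Max ((\<lambda>i. cmod (v $ i)) ` {..<n})"
  have "m \<in> (\<lambda>i. cmod (v $ i)) ` {..<n}" unfolding m_def using i0 by (intro Max_in) auto
  then obtain i where i: "i < n" "m = cmod (v $ i)" by auto
  have le: "cmod (v $ j) \<le> m" if "j < n" for j unfolding m_def using that by (intro Max_ge) auto
  have m: "m > 0" using le[OF i0(1)] i0(2) by (smt (verit) zero_less_norm_iff)
  have "z * v $ i = (A *\<^sub>v v) $ i" using v i by simp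
  also have "\<dots> = (\<Sum>j<n. A $$ (i, j) * v $ j)"
    using v(1) i A by (simp add: scalar_prod_def lessThan_atLeast0)
  finally have "cmod z * m = cmod (\<Sum>j<n. A $$ (i, j) * v $ j)" using i by (metis norm_mult)
  also have "\<dots> \<le> (\<Sum>j<n. cmod (A $$ (i, j)) * m)"
    by (intro order.trans[OF norm_sum] sum_mono) (auto simp: norm_mult intro!: mult_left_mono le)
  also have "\<dots> \<le> 1 * m" unfolding sum_distrib_right[symmetric] using row[OF i(1)] m
    by (intro mult_right_mono) auto
  finally show ?thesis using m by simp
qed

section \<open>Convexity\<close>

text \<open>The second derivative is \<open>(x - 2) / (x - 1)\<^sup>2\<close>, which is nonnegative
  from 2 on; all core degrees lie in this range.\<close>

lemma convex_on_mult_ln_pred: "convex_on {2..} (\<lambda>x::real. x * ln (x - 1))"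
proof (rule f''_ge0_imp_convex)
  fix x :: real assume x: "x \<in> {2..}"
  show "((\<lambda>x. x * ln (x - 1)) has_real_derivative (ln (x - 1) + x / (x - 1))) (at x)"
    using x by (auto intro!: derivative_eq_intros)
  have "((\<lambda>x. ln (x - 1) + x / (x - 1)) has_real_derivative
      (1 / (x - 1) + (1 * (x - 1) - x * 1) / ((x - 1) * (x - 1)))) (at x)"
    using x by (auto intro!: derivative_eq_intros)
  moreover have "1 / y + (1 * y - (y + 1) * 1) / (y * y) = (y - 1) / y\<^sup>2" if "y > 0" for y :: real
    using that by (simp add: field_simps power2_eq_square)
  from this[of "x - 1"]
  have "1 / (x - 1) + (1 * (x - 1) - x * 1) / ((x - 1) * (x - 1)) = (x - 2) / (x - 1)\<^sup>2"
    using x by (simp add: diff_diff_eq)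
  ultimately show "((\<lambda>x. ln (x - 1) + x / (x - 1)) has_real_derivative ((x - 2) / (x - 1)\<^sup>2)) (at x)"
    by metis
  show "0 \<le> (x - 2) / (x - 1)\<^sup>2" using x by simp
qed simp

text \<open>Jensen's inequality for the concave logarithm, from its tangent at the weighted mean
  \<open>m\<close>. The weights are not normalised, because they will be core degrees or the
  constant 1 on arcs.\<close>

lemma ln_sum_ge:
  fixes w a :: "'a \<Rightarrow> real"
  assumes "finite S" "\<And>i. i \<in> S \<Longrightarrow> w i \<ge> 0" "sum w S > 0" "\<And>i. i \<in> S \<Longrightarrow> a i > 0"
  shows "(\<Sum>i\<in>S. w i * ln (a i)) / sum w S \<le> ln ((\<Sum>i\<in>S. w i * a i) / sum w S)"
proof -
  define W where "W = sum w S"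
  define m where "m = (\<Sum>i\<in>S. w i * a i) / W"
  have W: "W > 0" using assms by (simp add: W_def)
  obtain i where "i \<in> S" "w i > 0"
    using assms(1-3) by (meson less_eq_real_def linorder_not_less sum_nonpos)
  then have "(\<Sum>i\<in>S. w i * a i) > 0"
    using assms by (intro sum_pos2[of S i]) (auto simp: less_imp_le)
  then have m: "m > 0" using W by (simp add: m_def)
  have "(\<Sum>i\<in>S. w i * ln (a i)) \<le> (\<Sum>i\<in>S. w i * (ln m + a i / m - 1))"
  proof (intro sum_mono mult_left_mono)
    fix i assume i: "i \<in> S"
    have "ln (a i / m) \<le> a i / m - 1" using assms(4)[OF i] m by (intro ln_le_minus_one) simp
    then show "ln (a i) \<le> ln m + a i / m - 1" using assms(4)[OF i] m by (simp add: ln_div)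
  qed (use assms in auto)
  also have "\<dots> = W * ln m + (\<Sum>i\<in>S. w i * a i) / m - W"
    by (simp add: algebra_simps sum.distrib sum_subtractf sum_distrib_left sum_distrib_right
        sum_divide_distrib W_def)
  also have "\<dots> = W * ln m" using W m by (simp add: m_def field_simps)
  finally show ?thesis using W unfolding W_def[symmetric] m_def[symmetric]
    by (simp add: field_simps)
qed

section \<open>Nonbacktracking walks in the core\<close>

text \<open>\<open>V\<close> is the vertex set of the graph and \<open>U\<close> that of its core.
  With two neighbours in \<open>U\<close> at every vertex of \<open>U\<close>, a nonbacktracking
  walk can always be continued.\<close>

locale core_graph =
  fixes V U :: "'a set" and adj :: "'a \<Rightarrow> 'a \<Rightarrow> bool"
  assumes finite_V: "finite V" and adj_sym: "adj x y \<Longrightarrow> adj y x"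
    and U_subset: "U \<subseteq> V" and core: "x \<in> U \<Longrightarrow> 2 \<le> card {y \<in> U. adj x y}"
begin

definition cnbrs :: "'a \<Rightarrow> 'a set" where "cnbrs x = {y \<in> U. adj x y}"
definition deg :: "'a \<Rightarrow> nat" where "deg x = card {y \<in> V. adj x y}"
definition cdeg :: "'a \<Rightarrow> nat" where "cdeg x = card (cnbrs x)"
text \<open>The normalisation uses degrees in the whole graph even between core vertices, since the
  spectrum in question is that of the whole graph.\<close>

definition nadj :: "'a \<Rightarrow> 'a \<Rightarrow> real" where
  "nadj x y = (if adj x y then 1 / sqrt (real (deg x) * real (deg y)) else 0)"

lemma finite_U [simp]: "finite U" using finite_V U_subset finite_subset by blast
lemma finite_cnbrs [simp]: "finite (cnbrs x)" by (simp add: cnbrs_def)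
lemma cnbrs_iff: "y \<in> cnbrs x \<longleftrightarrow> y \<in> U \<and> adj x y" by (simp add: cnbrs_def)
lemma cdeg_ge2: "x \<in> U \<Longrightarrow> 2 \<le> cdeg x" using core by (simp add: cdeg_def cnbrs_def)
lemma cdeg_le_deg: "cdeg x \<le> deg x"
  unfolding cdeg_def deg_def cnbrs_def using finite_V U_subset by (intro card_mono) auto
lemma nadj_nonneg: "nadj x y \<ge> 0" by (simp add: nadj_def)
lemma adj_commute: "adj x y \<longleftrightarrow> adj y x" using adj_sym by blast
lemma nadj_commute: "nadj x y = nadj y x" using adj_sym by (auto simp: nadj_def mult.commute)

text \<open>
  A nonbacktracking walk \<open>v\<^sub>0, \<dots>, v\<^sub>n\<close> is the list \<open>[v\<^sub>n, \<dots>, v\<^sub>0]\<close>, so its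
  one-step truncation is \<^const>\<open>tl\<close>; level \<open>j\<close> holds the walks with \<open>j + 1\<close> steps.
\<close>

fun nbw :: "nat \<Rightarrow> 'a list set" where
  "nbw 0 = {[y, x] | x y. x \<in> U \<and> y \<in> cnbrs x}"
| "nbw (Suc j) = {z # s | z s. s \<in> nbw j \<and> z \<in> cnbrs (hd s) - {hd (tl s)}}"

text \<open>The law of the nonbacktracking walk up to normalisation: each starting arc has mass 1,
  and at \<open>y\<close> each of the \<open>cdeg y - 1\<close> continuations is equally
  likely.\<close>

fun weight :: "'a list \<Rightarrow> real" where
  "weight (z # y # x # s) = weight (y # x # s) / (real (cdeg y) - 1)"
| "weight _ = 1"

lemma nbw_shape:
  assumes "s \<in> nbw j"
  obtains y x u where "s = y # x # u" "length u = j" "x \<in> U" "y \<in> cnbrs x"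
proof -
  have "\<exists>y x u. s = y # x # u \<and> length u = j \<and> x \<in> U \<and> y \<in> cnbrs x"
    using assms by (induction j arbitrary: s) (fastforce simp: cnbrs_iff)+
  with that show ?thesis by blast
qed

lemma nbw_Suc:
  "nbw (Suc j) = (\<Union>s\<in>nbw j. (\<lambda>z. z # s) ` (cnbrs (hd s) - {hd (tl s)}))"
  by auto

lemma finite_nbw [simp]: "finite (nbw j)"
proof (induction j)
  case 0
  have "nbw 0 \<subseteq> (\<lambda>(x, y). [y, x]) ` (U \<times> U)" by (auto simp: cnbrs_iff)
  then show ?case by (meson finite_SigmaI finite_U finite_imageI finite_subset)
next
  case (Suc j)
  then show ?case by (simp only: nbw_Suc finite_UN) auto
qed

lemma hd_nbw: "s \<in> nbw j \<Longrightarrow> hd s \<in> U"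
  by (elim nbw_shape) (simp add: cnbrs_iff)

lemma length_nbw: "s \<in> nbw j \<Longrightarrow> length s = j + 2"
  by (elim nbw_shape) simp

lemma weight_bounds: "s \<in> nbw j \<Longrightarrow> 0 < weight s \<and> weight s \<le> 1"
proof (induction j arbitrary: s)
  case 0
  then show ?case by auto
next
  case (Suc j)
  then obtain z t where t: "s = z # t" "t \<in> nbw j" by auto
  from nbw_shape[OF t(2)] obtain y x u where u: "t = y # x # u" "y \<in> cnbrs x" by metis
  then have "2 \<le> cdeg y" using cdeg_ge2 by (simp add: cnbrs_iff)
  with Suc.IH[OF t(2)] show ?case by (simp add: t(1) u(1) field_simps)
qed

section \<open>Stationarity of the nonbacktracking walk on arcs\<close>

lemma sum_nbw_Suc:
  "(\<Sum>s\<in>nbw (Suc j). g s) = (\<Sum>s\<in>nbw j. \<Sum>z\<in>cnbrs (hd s) - {hd (tl s)}. (g (z # s) :: real))"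
proof -
  have "(\<Sum>s\<in>nbw (Suc j). g s) =
      (\<Sum>s\<in>nbw j. sum g ((\<lambda>z. z # s) ` (cnbrs (hd s) - {hd (tl s)})))"
    unfolding nbw_Suc by (rule sum.UNION_disjoint) auto
  also have "\<dots> = (\<Sum>s\<in>nbw j. \<Sum>z\<in>cnbrs (hd s) - {hd (tl s)}. g (z # s))"
    by (intro sum.cong refl, subst sum.reindex) (auto simp: inj_on_def)
  finally show ?thesis .
qed

lemma sum_cnbrs: "(\<Sum>y\<in>cnbrs x. g y) = (\<Sum>y\<in>U. if adj x y then g y else (0 :: real))"
  by (simp add: cnbrs_def sum.inter_filter)

lemma sum_arcs_swap:
  "(\<Sum>x\<in>U. \<Sum>y\<in>cnbrs x. g x y) = (\<Sum>y\<in>U. \<Sum>x\<in>cnbrs y. (g x y :: real))"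
  unfolding sum_cnbrs by (subst sum.swap) (simp add: adj_commute)

text \<open>The last arc of the walk is uniform at every level: an arc \<open>(y, z)\<close>
  receives the fraction \<open>1 / (cdeg y - 1)\<close> of the mass of each of its
  \<open>cdeg y - 1\<close> predecessors \<open>(x, y)\<close> with \<open>x\<close> different from
  \<open>z\<close>. The function \<open>\<phi>\<close> varies in the induction because one step gets
  averaged into it.\<close>

lemma sum_weight_nbw:
  "(\<Sum>s\<in>nbw j. weight s * \<phi> (hd (tl s)) (hd s)) = (\<Sum>x\<in>U. \<Sum>y\<in>cnbrs x. \<phi> x y)"
proof (induction j arbitrary: \<phi>)
  case 0
  have img: "nbw 0 = (\<lambda>(x, y). [y, x]) ` (SIGMA x:U. cnbrs x)" by auto
  have inj: "inj_on (\<lambda>(x, y). [y, x]) (SIGMA x:U. cnbrs x)" by (auto simp: inj_on_def)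
  show ?case
    unfolding img sum.reindex[OF inj] by (simp add: sum.Sigma case_prod_beta o_def)
next
  case (Suc j)
  \<comment> \<open>The mean of \<open>\<phi>\<close> over the arcs that may follow
    \<open>(x, y)\<close>.\<close>
  define \<psi> where "\<psi> x y = (\<Sum>z\<in>cnbrs y - {x}. \<phi> y z / (real (cdeg y) - 1))" for x y
  have "(\<Sum>s\<in>nbw (Suc j). weight s * \<phi> (hd (tl s)) (hd s))
      = (\<Sum>s\<in>nbw j. weight s * \<psi> (hd (tl s)) (hd s))"
    unfolding sum_nbw_Suc
  proof (intro sum.cong refl)
    fix s assume "s \<in> nbw j"
    then show "(\<Sum>z\<in>cnbrs (hd s) - {hd (tl s)}. weight (z # s) * \<phi> (hd (tl (z # s))) (hd (z # s)))
        = weight s * \<psi> (hd (tl s)) (hd s)"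
      by (elim nbw_shape) (simp add: \<psi>_def sum_distrib_left)
  qed
  also have "\<dots> = (\<Sum>x\<in>U. \<Sum>y\<in>cnbrs x. \<psi> x y)" by (rule Suc.IH)
  \<comment> \<open>Reversing arcs groups the sum by the middle vertex \<open>y\<close>, so that its
    predecessors can be counted.\<close>
  also have "\<dots> = (\<Sum>y\<in>U. \<Sum>x\<in>cnbrs y. \<psi> x y)" by (rule sum_arcs_swap)
  also have "\<dots> = (\<Sum>y\<in>U. \<Sum>z\<in>cnbrs y. \<phi> y z)"
  proof (rule sum.cong[OF refl])
    fix y assume y: "y \<in> U"
    have "(\<Sum>x\<in>cnbrs y. \<psi> x y)
        = (\<Sum>x\<in>cnbrs y. \<Sum>z\<in>cnbrs y. if x \<noteq> z then \<phi> y z / (real (cdeg y) - 1) else 0)"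
      unfolding \<psi>_def by (rule sum.cong[OF refl], rule sum.mono_neutral_cong_left) auto
    also have "\<dots> = (\<Sum>z\<in>cnbrs y. \<Sum>x\<in>cnbrs y. if x \<noteq> z then \<phi> y z / (real (cdeg y) - 1) else 0)"
      by (rule sum.swap)
    also have "\<dots> = (\<Sum>z\<in>cnbrs y. \<phi> y z)"
    proof (intro sum.cong refl)
      fix z assume z: "z \<in> cnbrs y"
      have "(\<Sum>x\<in>cnbrs y. if x \<noteq> z then \<phi> y z / (real (cdeg y) - 1) else 0)
          = real (card (cnbrs y - {z})) * (\<phi> y z / (real (cdeg y) - 1))"
        by (subst sum.inter_filter[symmetric]) (auto simp: set_diff_eq)
      also have "card (cnbrs y - {z}) = cdeg y - 1" using z by (simp add: cdeg_def)
      finally show "(\<Sum>x\<in>cnbrs y. if x \<noteq> z then \<phi> y z / (real (cdeg y) - 1) else 0) = \<phi> y z"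
        using cdeg_ge2[OF y] by (simp add: of_nat_diff)
    qed
    finally show "(\<Sum>x\<in>cnbrs y. \<psi> x y) = (\<Sum>z\<in>cnbrs y. \<phi> y z)" .
  qed
  finally show ?case .
qed

section \<open>The forest of walks and its projection to the graph\<close>

definition walks :: "nat \<Rightarrow> 'a list set" where "walks r = (\<Union>j\<le>r. nbw j)"

text \<open>The forest operator \<open>M\<close>: a walk is joined to its one-step truncation, and
  \<open>hd\<close> projects a walk to its end vertex, from which the entry is lifted.\<close>

definition wadj :: "'a list \<Rightarrow> 'a list \<Rightarrow> real" where
  "wadj s t = (if tl s = t \<or> tl t = s then nadj (hd s) (hd t) else 0)"

lemma finite_walks [simp]: "finite (walks r)" by (simp add: walks_def)

lemma wadj_commute: "wadj s t = wadj t s"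
  unfolding wadj_def using nadj_commute[of "hd s" "hd t"] by auto

lemma sum_walks: "(\<Sum>s\<in>walks r. g s) = (\<Sum>j\<le>r. \<Sum>s\<in>nbw j. (g s :: real))"
  unfolding walks_def
  by (rule sum.UNION_disjoint) (auto dest!: length_nbw)

lemma nbw_in_walks: "s \<in> nbw j \<Longrightarrow> j \<le> r \<Longrightarrow> s \<in> walks r"
  by (auto simp: walks_def)

lemma walks_cases:
  assumes "s \<in> walks r"
  obtains y x u where "s = y # x # u" "x \<in> U" "y \<in> cnbrs x"
proof -
  from assms obtain j where "s \<in> nbw j" by (auto simp: walks_def)
  from nbw_shape[OF this] that show ?thesis by metis
qed

lemma walks_nonbacktracking: "z # y # x # u \<in> walks r \<Longrightarrow> z \<noteq> x"
proof -
  have "z \<noteq> x" if "z # y # x # u \<in> nbw j" for j using that by (cases j) auto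
  then show "z # y # x # u \<in> walks r \<Longrightarrow> z \<noteq> x" by (auto simp: walks_def)
qed

lemma hd_walks: "s \<in> walks r \<Longrightarrow> hd s \<in> V"
  using U_subset by (elim walks_cases) (auto simp: cnbrs_iff)

text \<open>The projection \<open>hd\<close> is injective on the neighbours of each walk, so paths
  in the forest project injectively to paths in \<open>V\<close>. The starting vertex
  \<open>last\<close> is constant along a forest path, whence the indicator.\<close>

lemma kpow_wadj_le:
  assumes "s \<in> walks r" "t \<in> walks r"
  shows "kpow (walks r) wadj k s t \<le> of_bool (last s = last t) * kpow V nadj k (hd s) (hd t)"
  using assms(1)
proof (induction k arbitrary: s)
  case (Suc k)
  define N where "N = {u \<in> walks r. tl s = u \<or> tl u = s}"
  obtain y x l where s: "s = y # x # l" using walks_cases[OF Suc.prems] by metis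
  \<comment> \<open>The truncation of \<open>s\<close> ends in \<open>x\<close>; the extensions of
    \<open>s\<close> end in distinct vertices, none of them \<open>x\<close>, as walks do not
    backtrack.\<close>
  have inj: "inj_on hd N"
  proof (rule inj_onI)
    fix a b assume a: "a \<in> N" and b: "b \<in> N" and eq: "hd a = hd b"
    from a obtain a1 a2 a' where a': "a = a1 # a2 # a'" by (metis (mono_tags) N_def mem_Collect_eq walks_cases)
    from b obtain b1 b2 b' where b': "b = b1 # b2 # b'" by (metis (mono_tags) N_def mem_Collect_eq walks_cases)
    show "a = b"
      using a b eq walks_nonbacktracking[of _ y x l r] unfolding N_def s a' b' by auto
  qed
  have last: "last u = last s" if u: "u \<in> N" for u
  proof -
    from u obtain u1 u2 u' where "u = u1 # u2 # u'" by (metis (mono_tags) N_def mem_Collect_eq walks_cases)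
    with u show ?thesis unfolding N_def s by auto
  qed
  have "kpow (walks r) wadj (Suc k) s t = (\<Sum>u\<in>N. nadj (hd s) (hd u) * kpow (walks r) wadj k u t)"
    unfolding kpow.simps(2) N_def by (rule sum.mono_neutral_cong_right) (auto simp: wadj_def)
  also have "\<dots> \<le> (\<Sum>u\<in>N. nadj (hd s) (hd u) * (of_bool (last s = last t) * kpow V nadj k (hd u) (hd t)))"
  proof (intro sum_mono mult_left_mono nadj_nonneg)
    fix u assume u: "u \<in> N"
    then have "u \<in> walks r" by (simp add: N_def)
    from Suc.IH[OF this] last[OF u]
    show "kpow (walks r) wadj k u t \<le> of_bool (last s = last t) * kpow V nadj k (hd u) (hd t)" by simp
  qed
  also have "\<dots> = of_bool (last s = last t) * (\<Sum>v\<in>hd ` N. nadj (hd s) v * kpow V nadj k v (hd t))"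
    by (subst sum.reindex[OF inj]) (simp add: sum_distrib_left mult_ac)
  also have "\<dots> \<le> of_bool (last s = last t) * (\<Sum>v\<in>V. nadj (hd s) v * kpow V nadj k v (hd t))"
    by (intro mult_left_mono sum_mono2 finite_V)
      (auto simp: N_def hd_walks intro!: mult_nonneg_nonneg nadj_nonneg kpow_nonneg)
  finally show ?case by simp
qed auto

section \<open>Counting walks with a prescribed start or end\<close>

lemma card_nbw_last:
  assumes "\<And>x. x \<in> U \<Longrightarrow> cdeg x \<le> \<Delta>"
  shows "card {s \<in> nbw j. last s = a} \<le> \<Delta> ^ Suc j"
proof (induction j)
  case 0
  show ?case
  proof (cases "a \<in> U")
    case True
    have "{s \<in> nbw 0. last s = a} \<subseteq> (\<lambda>y. [y, a]) ` cnbrs a" by auto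
    then have "card {s \<in> nbw 0. last s = a} \<le> card (cnbrs a)"
      by (meson card_image_le card_mono finite_cnbrs finite_imageI le_trans)
    then show ?thesis using assms[OF True] by (simp add: cdeg_def)
  next
    case False
    then have "{s \<in> nbw 0. last s = a} = {}" by auto
    then show ?thesis by (simp only: card.empty le0)
  qed
next
  case (Suc j)
  have "{s \<in> nbw (Suc j). last s = a} \<subseteq>
      (\<Union>s\<in>{s \<in> nbw j. last s = a}. (\<lambda>z. z # s) ` cnbrs (hd s))"
  proof
    fix u assume "u \<in> {s \<in> nbw (Suc j). last s = a}"
    then obtain z s where u: "u = z # s" "s \<in> nbw j" "z \<in> cnbrs (hd s)" "last u = a" by auto
    then have "last s = a" using length_nbw[OF u(2)] by auto
    with u show "u \<in> (\<Union>s\<in>{s \<in> nbw j. last s = a}. (\<lambda>z. z # s) ` cnbrs (hd s))" by blast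
  qed
  then have "card {s \<in> nbw (Suc j). last s = a} \<le>
      card (\<Union>s\<in>{s \<in> nbw j. last s = a}. (\<lambda>z. z # s) ` cnbrs (hd s))"
    by (intro card_mono) auto
  also have "\<dots> \<le> (\<Sum>s\<in>{s \<in> nbw j. last s = a}. card ((\<lambda>z. z # s) ` cnbrs (hd s)))"
    by (intro card_UN_le) simp
  also have "\<dots> \<le> (\<Sum>s\<in>{s \<in> nbw j. last s = a}. \<Delta>)"
  proof (intro sum_mono)
    fix s assume "s \<in> {s \<in> nbw j. last s = a}"
    then have "hd s \<in> U" using hd_nbw by blast
    then show "card ((\<lambda>z. z # s) ` cnbrs (hd s)) \<le> \<Delta>"
      using assms by (subst card_image) (auto simp: inj_on_def cdeg_def)
  qed
  also have "\<dots> \<le> \<Delta> ^ Suc (Suc j)" using Suc.IH by simp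
  finally show ?case .
qed

text \<open>Removing the final vertex \<open>a\<close> leaves a walk that ends in a neighbour of
  \<open>a\<close>, so \<open>a\<close> has to vary in the induction.\<close>

lemma card_nbw_hd:
  assumes "\<And>x. x \<in> U \<Longrightarrow> cdeg x \<le> \<Delta>"
  shows "card {s \<in> nbw j. hd s = a} \<le> \<Delta> ^ Suc j"
proof (induction j arbitrary: a)
  case 0
  show ?case
  proof (cases "a \<in> U")
    case True
    have "{s \<in> nbw 0. hd s = a} \<subseteq> (\<lambda>y. [a, y]) ` cnbrs a"
      using adj_sym by (auto simp: cnbrs_iff)
    then have "card {s \<in> nbw 0. hd s = a} \<le> card (cnbrs a)"
      by (meson card_image_le card_mono finite_cnbrs finite_imageI le_trans)
    then show ?thesis using assms[OF True] by (simp add: cdeg_def)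
  next
    case False
    then have "{s \<in> nbw 0. hd s = a} = {}" by (auto simp: cnbrs_iff)
    then show ?thesis by (simp only: card.empty le0)
  qed
next
  case (Suc j)
  show ?case
  proof (cases "a \<in> U")
    case True
    have "{s \<in> nbw (Suc j). hd s = a} \<subseteq> (\<Union>y\<in>cnbrs a. Cons a ` {s \<in> nbw j. hd s = y})"
    proof
      fix u assume "u \<in> {s \<in> nbw (Suc j). hd s = a}"
      then obtain s where u: "u = a # s" "s \<in> nbw j" "a \<in> cnbrs (hd s)" by auto
      then have "hd s \<in> cnbrs a" using hd_nbw[OF u(2)] adj_sym by (simp add: cnbrs_iff)
      with u show "u \<in> (\<Union>y\<in>cnbrs a. Cons a ` {s \<in> nbw j. hd s = y})" by blast
    qed
    then have "card {s \<in> nbw (Suc j). hd s = a} \<le>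
        card (\<Union>y\<in>cnbrs a. Cons a ` {s \<in> nbw j. hd s = y})"
      by (intro card_mono) auto
    also have "\<dots> \<le> (\<Sum>y\<in>cnbrs a. card (Cons a ` {s \<in> nbw j. hd s = y}))"
      by (intro card_UN_le) simp
    also have "\<dots> \<le> (\<Sum>y\<in>cnbrs a. \<Delta> ^ Suc j)"
    proof (rule sum_mono)
      fix y
      show "card (Cons a ` {s \<in> nbw j. hd s = y}) \<le> \<Delta> ^ Suc j"
        by (intro order.trans[OF card_image_le Suc.IH]) simp
    qed
    also have "\<dots> = cdeg a * \<Delta> ^ Suc j" by (simp add: cdeg_def)
    also have "\<dots> \<le> \<Delta> * \<Delta> ^ Suc j" using assms[OF True] by (intro mult_right_mono) auto
    finally show ?thesis by simp
  next
    case False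
    then have "{s \<in> nbw (Suc j). hd s = a} = {}" by (auto simp: cnbrs_iff)
    then show ?thesis by (simp only: card.empty le0)
  qed
qed

lemma card_walks_le:
  assumes "\<And>j. j \<le> r \<Longrightarrow> card {s \<in> nbw j. P s} \<le> \<Delta> ^ Suc j" "\<Delta> \<ge> 1"
  shows "card {s \<in> walks r. P s} \<le> Suc r * \<Delta> ^ Suc r"
proof -
  have "card {s \<in> walks r. P s} = card (\<Union>j\<le>r. {s \<in> nbw j. P s})"
    by (rule arg_cong[of _ _ card]) (auto simp: walks_def)
  also have "\<dots> \<le> (\<Sum>j\<le>r. card {s \<in> nbw j. P s})" by (intro card_UN_le) simp
  also have "\<dots> \<le> (\<Sum>j\<le>r. \<Delta> ^ Suc r)"
    using assms by (intro sum_mono) (meson atMost_iff le_trans power_increasing Suc_le_mono)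
  finally show ?thesis by simp
qed

section \<open>The Rayleigh quotient of the test function and the sum of return weights\<close>

definition narcs :: real where "narcs = (\<Sum>x\<in>U. real (cdeg x))"

text \<open>Every level but the lowest contributes the same arc sum through the pairs of a walk and
  its truncation, by stationarity; the factor 2 comes from the two orders of such a pair.\<close>

lemma qform_walks_ge:
  "2 * real r * (\<Sum>y\<in>U. \<Sum>z\<in>cnbrs y. sqrt (real (cdeg y) - 1) * nadj y z)
    \<le> qform (walks r) wadj (\<lambda>s. sqrt (weight s))"
proof -
  define F where "F s = sqrt (weight s)" for s
  \<comment> \<open>One half of \<open>wadj\<close>, with \<open>s\<close> the truncation of
    \<open>t\<close>; the other half is its transpose.\<close>
  define a where "a s t = (if tl t = s then nadj (hd s) (hd t) else 0)" for s t
  define T where "T = (\<Sum>y\<in>U. \<Sum>z\<in>cnbrs y. sqrt (real (cdeg y) - 1) * nadj y z)"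
  have split: "wadj s t = a s t + a t s" if "s \<in> walks r" "t \<in> walks r" for s t
  proof -
    have "\<not> (tl s = t \<and> tl t = s)" using that(2) by (auto elim!: walks_cases)
    then show ?thesis using nadj_commute[of "hd s" "hd t"] by (auto simp: wadj_def a_def)
  qed
  have a: "(\<Sum>s\<in>walks r. \<Sum>t\<in>walks r. F s * a s t * F t) \<ge> real r * T"
  proof -
    have nn: "F s * a s t * F t \<ge> 0" if "s \<in> walks r" "t \<in> walks r" for s t
      using that weight_bounds
      by (auto simp: F_def a_def walks_def intro!: mult_nonneg_nonneg nadj_nonneg) (meson less_imp_le)+
    have "real r * T = (\<Sum>j<r. \<Sum>t\<in>nbw (Suc j). F (tl t) * a (tl t) t * F t)"
    proof -
      have "(\<Sum>t\<in>nbw (Suc j). F (tl t) * a (tl t) t * F t) = T" for j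
      proof -
        have "(\<Sum>t\<in>nbw (Suc j). F (tl t) * a (tl t) t * F t)
            = (\<Sum>t\<in>nbw (Suc j). weight t *
                (sqrt (real (cdeg (hd (tl t))) - 1) * nadj (hd (tl t)) (hd t)))"
        proof (intro sum.cong refl)
          fix t assume "t \<in> nbw (Suc j)"
          then obtain z s where t: "t = z # s" "s \<in> nbw j" by auto
          from nbw_shape[OF t(2)] obtain y x u where s: "s = y # x # u" "y \<in> cnbrs x" by metis
          then have d: "real (cdeg y) - 1 > 0" using cdeg_ge2[of y] by (simp add: cnbrs_iff)
          have w: "weight s > 0" using weight_bounds[OF t(2)] by simp
          \<comment> \<open>The weight drops by the factor \<open>cdeg y - 1\<close>, so the product
            of the two roots is the weight of the longer walk times
            \<open>sqrt (cdeg y - 1)\<close>. This makes the sum one to which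
            \<open>sum_weight_nbw\<close> applies.\<close>
          have "sqrt (weight s) * sqrt (weight s / (real (cdeg y) - 1))
              = weight s / sqrt (real (cdeg y) - 1)"
            using w d by (simp add: real_sqrt_divide)
          also have "\<dots> = weight s / (real (cdeg y) - 1) * sqrt (real (cdeg y) - 1)"
            using d by (simp add: field_simps)
          finally show "F (tl t) * a (tl t) t * F t
             = weight t * (sqrt (real (cdeg (hd (tl t))) - 1) * nadj (hd (tl t)) (hd t))"
            using s(1) t(1) by (simp add: F_def a_def mult_ac)
        qed
        also have "\<dots> = T" unfolding T_def by (rule sum_weight_nbw)
        finally show ?thesis .
      qed
      then show ?thesis by simp
    qed
    also have "\<dots> \<le> (\<Sum>j<r. \<Sum>t\<in>nbw (Suc j). \<Sum>s\<in>walks r. F s * a s t * F t)"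
    proof (intro sum_mono)
      fix j t assume j: "j \<in> {..<r}" and t: "t \<in> nbw (Suc j)"
      then have "tl t \<in> nbw j" by auto
      then have "tl t \<in> walks r" "t \<in> walks r"
        using j t by (auto simp del: nbw.simps intro: nbw_in_walks)
      then show "F (tl t) * a (tl t) t * F t \<le> (\<Sum>s\<in>walks r. F s * a s t * F t)"
        by (intro member_le_sum) (auto intro: nn)
    qed
    also have "\<dots> = (\<Sum>j\<in>{1..r}. \<Sum>t\<in>nbw j. \<Sum>s\<in>walks r. F s * a s t * F t)"
      by (rule sum.reindex_bij_witness[of _ "\<lambda>j. j - 1" Suc]) auto
    also have "\<dots> \<le> (\<Sum>j\<le>r. \<Sum>t\<in>nbw j. \<Sum>s\<in>walks r. F s * a s t * F t)"
      by (intro sum_mono2) (auto intro!: sum_nonneg nn intro: nbw_in_walks)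
    also have "\<dots> = (\<Sum>t\<in>walks r. \<Sum>s\<in>walks r. F s * a s t * F t)" by (simp add: sum_walks)
    also have "\<dots> = (\<Sum>s\<in>walks r. \<Sum>t\<in>walks r. F s * a s t * F t)" by (rule sum.swap)
    finally show ?thesis .
  qed
  have "qform (walks r) wadj F = (\<Sum>s\<in>walks r. \<Sum>t\<in>walks r. F s * a s t * F t)
      + (\<Sum>s\<in>walks r. \<Sum>t\<in>walks r. F s * a t s * F t)"
    unfolding qform_def sum.distrib[symmetric]
    by (intro sum.cong refl) (simp add: split algebra_simps)
  also have "(\<Sum>s\<in>walks r. \<Sum>t\<in>walks r. F s * a t s * F t)
      = (\<Sum>s\<in>walks r. \<Sum>t\<in>walks r. F s * a s t * F t)"
    by (subst sum.swap) (simp add: mult_ac)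
  finally show ?thesis using a by (simp add: T_def F_def)
qed

text \<open>By stationarity each of the \<open>r + 1\<close> levels has total weight
  \<open>narcs\<close>. Against the \<open>r\<close> levels counted in \<open>qform_walks_ge\<close>
  this yields the factor \<open>r / (r + 1)\<close>.\<close>

lemma sum_weight_walks: "(\<Sum>s\<in>walks r. (sqrt (weight s))\<^sup>2) = real (Suc r) * narcs"
proof -
  have "(\<Sum>s\<in>nbw j. (sqrt (weight s))\<^sup>2) = narcs" for j
  proof -
    have "(\<Sum>s\<in>nbw j. (sqrt (weight s))\<^sup>2) = (\<Sum>s\<in>nbw j. weight s * 1)"
      using weight_bounds by (intro sum.cong refl) (simp add: less_imp_le)
    also have "\<dots> = (\<Sum>x\<in>U. \<Sum>y\<in>cnbrs x. 1)" by (rule sum_weight_nbw)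
    finally show ?thesis by (simp add: narcs_def cdeg_def)
  qed
  then show ?thesis by (simp add: sum_walks)
qed

text \<open>The test function is at most 1, forest entries are dominated by entries over
  \<open>V\<close>, and these by the diagonal, for which the exponent must be even. One factor of
  the square counts the walks with the same start as a given one, the other the walks with a given
  end.\<close>

lemma qform_kpow_walks_le:
  assumes \<Delta>: "\<And>x. x \<in> U \<Longrightarrow> cdeg x \<le> \<Delta>" "\<Delta> \<ge> 1"
  shows "qform (walks r) (kpow (walks r) wadj (k + k)) (\<lambda>s. sqrt (weight s))
    \<le> (real (Suc r * \<Delta> ^ Suc r))\<^sup>2 * (\<Sum>x\<in>V. kpow V nadj (k + k) x x)"
proof -
  define S where "S = walks r"
  define c where "c = real (Suc r * \<Delta> ^ Suc r)"
  define q where "q x = kpow V nadj (k + k) x x" for x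
  define e where "e s t = (of_bool (last s = last t) :: real)" for s t :: "'a list"
  have q: "q x \<ge> 0" for x unfolding q_def by (intro kpow_nonneg nadj_nonneg)
  have F: "0 \<le> sqrt (weight s)" "sqrt (weight s) \<le> 1" if "s \<in> S" for s
    using that weight_bounds by (auto simp: S_def walks_def less_imp_le)
  have clast: "real (card {s \<in> S. last s = a}) \<le> c" for a
    unfolding c_def S_def of_nat_le_iff using \<Delta> by (intro card_walks_le card_nbw_last)
  have chd: "real (card {s \<in> S. hd s = a}) \<le> c" for a
    unfolding c_def S_def of_nat_le_iff using \<Delta> by (intro card_walks_le card_nbw_hd)
  have e_sum: "(\<Sum>s\<in>S. e s t) \<le> c" for t
    using clast[of "last t"] by (simp add: e_def of_bool_def sum.inter_filter[symmetric] S_def)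
  \<comment> \<open>The relation of having the same start is symmetric, so both diagonal terms
    contribute equally.\<close>
  have swap: "(\<Sum>s\<in>S. \<Sum>t\<in>S. e s t * q (hd s)) = (\<Sum>s\<in>S. \<Sum>t\<in>S. e s t * q (hd t))"
    by (subst sum.swap, intro sum.cong refl arg_cong2[where f = "(*)"]) (auto simp: e_def)
  have "qform S (kpow S wadj (k + k)) (\<lambda>s. sqrt (weight s))
      \<le> (\<Sum>s\<in>S. \<Sum>t\<in>S. e s t * ((q (hd s) + q (hd t)) / 2))"
    unfolding qform_def
  proof (intro sum_mono)
    fix s t assume st: "s \<in> S" "t \<in> S"
    have K: "kpow S wadj (k + k) s t \<ge> 0"
      by (intro kpow_nonneg) (simp add: wadj_def nadj_nonneg)
    have "sqrt (weight s) * kpow S wadj (k + k) s t * sqrt (weight t)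
        \<le> 1 * kpow S wadj (k + k) s t * 1"
      using F[OF st(1)] F[OF st(2)] K by (intro mult_mono) auto
    also have "\<dots> \<le> e s t * kpow V nadj (k + k) (hd s) (hd t)"
      using kpow_wadj_le[of s r t "k + k"] st by (simp add: e_def S_def)
    also have "\<dots> \<le> e s t * ((q (hd s) + q (hd t)) / 2)"
      unfolding q_def using st hd_walks nadj_commute
      by (intro mult_left_mono kpow_le_diagonal finite_V) (auto simp: e_def S_def)
    finally show "sqrt (weight s) * kpow S wadj (k + k) s t * sqrt (weight t)
        \<le> e s t * ((q (hd s) + q (hd t)) / 2)" .
  qed
  also have "\<dots> = ((\<Sum>s\<in>S. \<Sum>t\<in>S. e s t * q (hd s)) + (\<Sum>s\<in>S. \<Sum>t\<in>S. e s t * q (hd t))) / 2"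
    unfolding sum.distrib[symmetric] sum_divide_distrib
    by (intro sum.cong refl) (simp add: distrib_left)
  also have "\<dots> = (\<Sum>s\<in>S. \<Sum>t\<in>S. e s t * q (hd t))"
    unfolding swap by simp
  also have "\<dots> = (\<Sum>t\<in>S. (\<Sum>s\<in>S. e s t) * q (hd t))"
    by (subst sum.swap) (simp add: sum_distrib_right)
  also have "\<dots> \<le> (\<Sum>t\<in>S. c * q (hd t))"
    by (intro sum_mono mult_right_mono e_sum q)
  also have "\<dots> = (\<Sum>x\<in>V. \<Sum>t\<in>{t \<in> S. hd t = x}. c * q (hd t))"
    using finite_V hd_walks by (intro sum.group[symmetric]) (auto simp: S_def)
  also have "\<dots> = (\<Sum>x\<in>V. real (card {t \<in> S. hd t = x}) * (c * q x))"
    by (intro sum.cong refl) simp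
  also have "\<dots> \<le> (\<Sum>x\<in>V. c * (c * q x))"
    by (intro sum_mono mult_right_mono chd mult_nonneg_nonneg q) (simp add: c_def)
  also have "\<dots> = c\<^sup>2 * (\<Sum>x\<in>V. q x)" by (simp add: sum_distrib_left power2_eq_square mult_ac)
  finally show ?thesis unfolding S_def c_def q_def .
qed

text \<open>Jensen's inequality passes to the mean of logarithms over arcs, which splits into sums
  over vertices. Convexity of \<open>x * ln (x - 1)\<close> then bounds the numerator and concavity
  of \<open>ln\<close> the denominator.\<close>

lemma arcs_mean_ge:
  assumes "U \<noteq> {}"
  shows "narcs * (sqrt (narcs / card U - 1) / ((\<Sum>x\<in>U. real (cdeg x) * real (deg x)) / narcs))
    \<le> (\<Sum>y\<in>U. \<Sum>z\<in>cnbrs y. sqrt (real (cdeg y) - 1) * nadj y z)"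
proof -
  define B where "B = (\<Sum>x\<in>U. real (cdeg x) * real (deg x))"
  define A where "A = (SIGMA y:U. cnbrs y)"
  define \<tau> where "\<tau> y z = sqrt (real (cdeg y) - 1) * nadj y z" for y z
  have cU: "real (card U) > 0" using assms by (simp add: card_gt_0_iff)
  have c2: "real (cdeg x) \<ge> 2" if "x \<in> U" for x using cdeg_ge2[OF that] by simp
  have d2: "real (deg x) \<ge> 2" if "x \<in> U" for x using c2[OF that] cdeg_le_deg[of x] by linarith
  have d0: "0 < deg x" if "x \<in> U" for x using d2[OF that] by simp
  have n2: "narcs \<ge> 2 * real (card U)"
    using sum_mono[of U "\<lambda>_. 2" "\<lambda>x. real (cdeg x)"] c2 by (simp add: narcs_def mult.commute)
  with cU have n0: "narcs > 0" by linarith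
  have m2: "narcs / card U \<ge> 2" using n2 cU by (simp add: field_simps)
  have "2 * narcs \<le> B"
    unfolding narcs_def B_def sum_distrib_left
    by (intro sum_mono) (metis d2 mult.commute mult_left_mono of_nat_0_le_iff)
  with n0 have B0: "B > 0" by linarith
  have fA: "finite A" by (simp add: A_def)
  have cA: "real (card A) = narcs" by (simp add: A_def narcs_def cdeg_def)
  have \<tau>0: "\<tau> y z > 0" and ln\<tau>: "ln (\<tau> y z) = ln (real (cdeg y) - 1) / 2 - ln (deg y) / 2 - ln (deg z) / 2"
    if "y \<in> U" "z \<in> cnbrs y" for y z
  proof -
    have zU: "z \<in> U" and "adj y z" using that by (auto simp: cnbrs_iff)
    then have eq: "\<tau> y z = sqrt (real (cdeg y) - 1) / sqrt (real (deg y) * real (deg z))"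
      by (simp add: \<tau>_def nadj_def)
    show "\<tau> y z > 0" unfolding eq using c2[OF that(1)] d2[OF that(1)] d2[OF zU]
      by (intro divide_pos_pos) auto
    show "ln (\<tau> y z) = ln (real (cdeg y) - 1) / 2 - ln (deg y) / 2 - ln (deg z) / 2"
      unfolding eq using c2[OF that(1)] d2[OF that(1)] d2[OF zU]
      by (simp add: ln_div ln_sqrt ln_mult field_simps)
  qed
  have "(\<Sum>y\<in>U. \<Sum>z\<in>cnbrs y. ln (\<tau> y z))
      = (\<Sum>y\<in>U. \<Sum>z\<in>cnbrs y. ln (real (cdeg y) - 1) / 2 - ln (deg y) / 2 - ln (deg z) / 2)"
    by (intro sum.cong refl) (simp add: ln\<tau>)
  also have "\<dots> = (\<Sum>y\<in>U. \<Sum>z\<in>cnbrs y. ln (real (cdeg y) - 1) / 2 - ln (deg y) / 2)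
      - (\<Sum>y\<in>U. \<Sum>z\<in>cnbrs y. ln (deg z) / 2)"
    by (simp add: sum_subtractf)
  \<comment> \<open>Reversing arcs turns the half logarithm at the head into one at the tail;
    together they give a full \<open>ln (deg y)\<close>.\<close>
  also have "(\<Sum>y\<in>U. \<Sum>z\<in>cnbrs y. ln (real (deg z)) / 2) = (\<Sum>y\<in>U. \<Sum>z\<in>cnbrs y. ln (real (deg y)) / 2)"
    by (rule sum_arcs_swap)
  also have "(\<Sum>y\<in>U. \<Sum>z\<in>cnbrs y. ln (real (cdeg y) - 1) / 2 - ln (deg y) / 2) - \<dots>
      = (\<Sum>y\<in>U. real (cdeg y) * ln (real (cdeg y) - 1)) / 2 - (\<Sum>y\<in>U. real (cdeg y) * ln (deg y))"
    by (simp add: cdeg_def[symmetric] sum_subtractf[symmetric] sum_divide_distrib algebra_simps)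
  finally have S: "(\<Sum>y\<in>U. \<Sum>z\<in>cnbrs y. ln (\<tau> y z))
      = (\<Sum>y\<in>U. real (cdeg y) * ln (real (cdeg y) - 1)) / 2 - (\<Sum>y\<in>U. real (cdeg y) * ln (deg y))" .
  \<comment> \<open>Jensen for the uniform measure on \<open>U\<close>, whose mean core degree is
    \<open>narcs / card U\<close>.\<close>
  have 1: "narcs * ln (narcs / card U - 1) \<le> (\<Sum>y\<in>U. real (cdeg y) * ln (real (cdeg y) - 1))"
  proof -
    have *: "(\<Sum>y\<in>U. (1 / card U) *\<^sub>R real (cdeg y)) = narcs / card U"
      by (simp add: narcs_def sum_divide_distrib)
    have "narcs / card U * ln (narcs / card U - 1)
        \<le> (\<Sum>y\<in>U. (1 / card U) * (real (cdeg y) * ln (real (cdeg y) - 1)))"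
      unfolding *[symmetric]
      by (rule convex_on_sum[OF _ assms convex_on_mult_ln_pred]) (use cU c2 in auto)
    also have "\<dots> = (\<Sum>y\<in>U. real (cdeg y) * ln (real (cdeg y) - 1)) / card U"
      by (simp add: sum_divide_distrib)
    finally show ?thesis using cU assms by (simp add: field_simps)
  qed
  \<comment> \<open>Jensen with the core degrees as weights, that is, for the tail of a uniform
    arc.\<close>
  have 2: "(\<Sum>y\<in>U. real (cdeg y) * ln (deg y)) \<le> narcs * ln (B / narcs)"
  proof -
    have "(\<Sum>y\<in>U. real (cdeg y) * ln (deg y)) / narcs \<le> ln (B / narcs)"
      unfolding narcs_def B_def
      by (rule ln_sum_ge) (use n0 d0 in \<open>auto simp: narcs_def\<close>)
    then show ?thesis using n0 by (simp add: field_simps)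
  qed
  have SA: "(\<Sum>p\<in>A. h (fst p) (snd p)) = (\<Sum>y\<in>U. \<Sum>z\<in>cnbrs y. (h y z :: real))" for h
    unfolding A_def by (simp add: sum.Sigma case_prod_beta)
  \<comment> \<open>Jensen for the uniform measure on the arcs themselves.\<close>
  have "(\<Sum>p\<in>A. 1 * ln (\<tau> (fst p) (snd p))) / sum (\<lambda>_. 1) A
      \<le> ln ((\<Sum>p\<in>A. 1 * \<tau> (fst p) (snd p)) / sum (\<lambda>_. 1) A)"
    by (rule ln_sum_ge) (use fA cA n0 \<tau>0 in \<open>auto simp: A_def\<close>)
  then have 3: "(\<Sum>y\<in>U. \<Sum>z\<in>cnbrs y. ln (\<tau> y z)) / narcs \<le> ln ((\<Sum>y\<in>U. \<Sum>z\<in>cnbrs y. \<tau> y z) / narcs)"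
    using SA[of "\<lambda>y z. ln (\<tau> y z)"] SA[of \<tau>] cA by simp
  define T where "T = (\<Sum>y\<in>U. \<Sum>z\<in>cnbrs y. \<tau> y z)"
  have "A \<noteq> {}" using cA n0 by auto
  then obtain p where p: "p \<in> A" by blast
  have "sum (\<lambda>p. \<tau> (fst p) (snd p)) A > 0"
    using p fA \<tau>0 by (intro sum_pos2[of A p]) (auto simp: A_def less_imp_le)
  then have T: "T > 0" using SA[of \<tau>] by (simp add: T_def)
  have "ln (sqrt (narcs / card U - 1) / (B / narcs)) = ln (narcs / card U - 1) / 2 - ln (B / narcs)"
    using m2 B0 n0 by (subst ln_div) (auto simp: ln_sqrt)
  also have "\<dots> = (narcs * ln (narcs / card U - 1) / 2 - narcs * ln (B / narcs)) / narcs"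
    using n0 by (simp add: field_simps)
  also have "\<dots> \<le> ln (T / narcs)"
    using order.trans[OF divide_right_mono 3[unfolded S, folded T_def], of "narcs * ln (narcs / card U - 1) / 2 - narcs * ln (B / narcs)"]
      1 2 n0 by simp
  finally have "sqrt (narcs / card U - 1) / (B / narcs) \<le> T / narcs"
    using m2 B0 n0 T by (subst (asm) ln_le_cancel_iff) auto
  then show ?thesis using n0 unfolding T_def \<tau>_def B_def by (simp add: pos_le_divide_eq mult.commute)
qed

text \<open>The Rayleigh bound is raised to the power \<open>2 ^ p\<close> on the forest and then
  compared with the closed walks in \<open>V\<close>. The condition \<open>0 < p\<close> makes the
  exponent even.\<close>

lemma return_sum_ge:
  assumes \<Delta>: "\<And>x. x \<in> U \<Longrightarrow> cdeg x \<le> \<Delta>" "\<Delta> \<ge> 1" and "U \<noteq> {}" and "0 < p"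
  defines "\<rho> \<equiv> 2 * sqrt (narcs / card U - 1) / ((\<Sum>x\<in>U. real (cdeg x) * real (deg x)) / narcs)"
  shows "(real r / real (Suc r) * \<rho>) ^ (2 ^ p) * real (card U)
    \<le> (real (Suc r * \<Delta> ^ Suc r))\<^sup>2 * (\<Sum>x\<in>V. kpow V nadj (2 ^ p) x x)"
proof -
  obtain p' where p': "p = Suc p'" using \<open>0 < p\<close> by (cases p) auto
  have c2: "real (cdeg x) \<ge> 2" if "x \<in> U" for x using cdeg_ge2[OF that] by simp
  have n2: "narcs \<ge> 2 * real (card U)"
    using sum_mono[of U "\<lambda>_. 2" "\<lambda>x. real (cdeg x)"] c2 by (simp add: narcs_def mult.commute)
  have cU: "real (card U) > 0" using assms by (simp add: card_gt_0_iff)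
  have "\<rho> \<ge> 0" unfolding \<rho>_def using n2 cU
    by (intro divide_nonneg_nonneg mult_nonneg_nonneg) (auto simp: field_simps intro!: sum_nonneg)
  define R where "R = real r / real (Suc r) * \<rho>"
  have "R \<ge> 0" using \<open>\<rho> \<ge> 0\<close> by (simp add: R_def)
  have "R * (\<Sum>s\<in>walks r. (sqrt (weight s))\<^sup>2) = 2 * real r * (narcs * (\<rho> / 2))"
    unfolding sum_weight_walks R_def by simp
  also have "\<dots> \<le> 2 * real r * (\<Sum>y\<in>U. \<Sum>z\<in>cnbrs y. sqrt (real (cdeg y) - 1) * nadj y z)"
    using arcs_mean_ge[OF \<open>U \<noteq> {}\<close>] by (intro mult_left_mono) (auto simp: \<rho>_def)
  also have "\<dots> \<le> qform (walks r) wadj (\<lambda>s. sqrt (weight s))" by (rule qform_walks_ge)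
  finally have "R ^ (2 ^ p) * (\<Sum>s\<in>walks r. (sqrt (weight s))\<^sup>2)
      \<le> qform (walks r) (kpow (walks r) wadj (2 ^ p)) (\<lambda>s. sqrt (weight s))"
    by (intro qform_power2_ge finite_walks wadj_commute \<open>R \<ge> 0\<close>)
  also have "\<dots> \<le> (real (Suc r * \<Delta> ^ Suc r))\<^sup>2 * (\<Sum>x\<in>V. kpow V nadj (2 ^ p) x x)"
    using qform_kpow_walks_le[OF \<Delta>, of r "2 ^ p'"] by (simp add: p' mult_2)
  finally have *: "R ^ (2 ^ p) * (real (Suc r) * narcs)
      \<le> (real (Suc r * \<Delta> ^ Suc r))\<^sup>2 * (\<Sum>x\<in>V. kpow V nadj (2 ^ p) x x)"
    unfolding sum_weight_walks .
  \<comment> \<open>Core degrees are at least 2, so the total weight may be replaced by the number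
    of core vertices.\<close>
  have "1 * real (card U) \<le> real (Suc r) * narcs"
    using n2 cU by (intro mult_mono) auto
  then have "R ^ (2 ^ p) * real (card U) \<le> R ^ (2 ^ p) * (real (Suc r) * narcs)"
    using \<open>R \<ge> 0\<close> by (intro mult_left_mono) auto
  with * show ?thesis unfolding R_def by linarith
qed

end

section \<open>Spectra of graphs\<close>

text \<open>The Markov kernel is \<open>nadj\<close> conjugated by the square roots of the degrees.
  On the diagonal these roots cancel, so the traces of all powers agree.\<close>

lemma (in core_graph) kpow_walk_eq:
  assumes pos: "\<And>x. x \<in> V \<Longrightarrow> deg x > 0" and x: "x \<in> V"
  shows "kpow V (\<lambda>x y. if adj x y then 1 / real (deg x) else 0) k x y * sqrt (deg x)
    = kpow V nadj k x y * sqrt (deg y)"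
  using x
proof (induction k arbitrary: x)
  case (Suc k)
  define P where "P = (\<lambda>x y. if adj x y then 1 / real (deg x) else 0)"
  have P: "P x z * w * sqrt (deg x) = nadj x z * (w * sqrt (deg z))" if "z \<in> V" for z w
  proof -
    have "P x z * sqrt (deg x) = nadj x z * sqrt (deg z)"
      using pos[OF that] pos[OF Suc.prems]
      by (simp add: P_def nadj_def real_sqrt_mult real_div_sqrt divide_simps)
    then have "w * (P x z * sqrt (deg x)) = w * (nadj x z * sqrt (deg z))" by (rule arg_cong)
    then show ?thesis by (simp only: mult_ac)
  qed
  have "kpow V P (Suc k) x y * sqrt (deg x) = (\<Sum>z\<in>V. nadj x z * (kpow V P k z y * sqrt (deg z)))"
    unfolding kpow.simps(2) sum_distrib_right by (intro sum.cong refl P)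
  also have "\<dots> = (\<Sum>z\<in>V. nadj x z * (kpow V nadj k z y * sqrt (deg y)))"
    using Suc.IH by (intro sum.cong refl) (simp add: P_def)
  also have "\<dots> = kpow V nadj (Suc k) x y * sqrt (deg y)"
    by (simp add: sum_distrib_right mult.assoc)
  finally show ?case unfolding P_def .
qed simp

section \<open>Degrees, edges, connectivity and the 2-core\<close>

context graph
begin

lemma out_degree_eq_card_nbrs: "out_degree G x = card {y \<in> verts G. x \<rightarrow>\<^bsub>G\<^esub> y}"
proof -
  have "bij_betw (head G) (out_arcs G x) {y \<in> verts G. x \<rightarrow>\<^bsub>G\<^esub> y}"
    unfolding bij_betw_def
  proof
    show "inj_on (head G) (out_arcs G x)"
      by (auto intro!: inj_onI no_multi_arcs simp: arc_to_ends_def)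
    show "head G ` out_arcs G x = {y \<in> verts G. x \<rightarrow>\<^bsub>G\<^esub> y}"
      by (force simp: arcs_ends_conv)
  qed
  then show ?thesis unfolding out_degree_def by (rule bij_betw_same_card)
qed

lemma adj_commute: "x \<rightarrow>\<^bsub>G\<^esub> y \<longleftrightarrow> y \<rightarrow>\<^bsub>G\<^esub> x"
  using arcs_ends_symmetric[OF sym_arcs, of x y] arcs_ends_symmetric[OF sym_arcs, of y x]
  by (rule iffI)

text \<open>Arcs are counted by tail and by undirected edge. Each edge comes from exactly two arcs:
  without loops the opposite arcs differ, and without parallel arcs there are no others.\<close>

lemma handshake: "2 * card (edges G) = (\<Sum>v\<in>verts G. out_degree G v)"
proof -
  define \<phi> where "\<phi> e = {tail G e, head G e}" for e
  have fibre: "card {e \<in> arcs G. \<phi> e = E} = 2" if "E \<in> edges G" for E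
  proof -
    from that obtain e where e: "e \<in> arcs G" "E = \<phi> e" by (auto simp: edges_def \<phi>_def)
    then obtain e' where e': "e' \<in> arcs G" "tail G e = head G e'" "head G e = tail G e'"
      using sym_arcs unfolding symmetric_conv by blast
    have ne: "e \<noteq> e'" using no_loops[OF e(1)] e' by auto
    have "{e \<in> arcs G. \<phi> e = E} = {e, e'}"
    proof (intro equalityI subsetI)
      fix a assume "a \<in> {e \<in> arcs G. \<phi> e = E}"
      then have a: "a \<in> arcs G" "\<phi> a = \<phi> e" using e by auto
      then have "arc_to_ends G a = arc_to_ends G e \<or> arc_to_ends G a = arc_to_ends G e'"
        using e' by (auto simp: \<phi>_def arc_to_ends_def doubleton_eq_iff)
      then show "a \<in> {e, e'}" using no_multi_arcs[OF a(1)] e(1) e'(1) by auto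
    qed (use e e' in \<open>auto simp: \<phi>_def\<close>)
    with ne show ?thesis by simp
  qed
  have "card (arcs G) = (\<Sum>E\<in>edges G. \<Sum>e\<in>{e \<in> arcs G. \<phi> e = E}. 1)"
    by (subst sum.group) (auto simp: edges_def \<phi>_def)
  also have "\<dots> = 2 * card (edges G)" using fibre by simp
  finally have "2 * card (edges G) = card (arcs G)" by simp
  also have "\<dots> = (\<Sum>v\<in>verts G. \<Sum>e\<in>{e \<in> arcs G. tail G e = v}. 1)"
    by (subst sum.group) auto
  also have "\<dots> = (\<Sum>v\<in>verts G. out_degree G v)"
    by (simp add: out_degree_def out_arcs_def)
  finally show ?thesis .
qed

text \<open>If no arc left \<open>W\<close>, everything reachable from \<open>W\<close> would stay
  in it. This form of connectivity is convenient to carry through the removal of leaves.\<close>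

lemma connected_cut:
  assumes "Digraph_Component.connected G" "W \<noteq> {}" "W \<subset> verts G"
  shows "\<exists>a\<in>W. \<exists>b\<in>verts G - W. a \<rightarrow>\<^bsub>G\<^esub> b"
proof (rule ccontr)
  assume neg: "\<not> ?thesis"
  obtain u v where u: "u \<in> W" and v: "v \<in> verts G" "v \<notin> W" using assms(2,3) by auto
  have "u \<rightarrow>\<^sup>*\<^bsub>G\<^esub> v"
    using assms(1,3) u v unfolding Digraph_Component.connected_def strongly_connected_def
    by (auto simp: reachable_mk_symmetric_eq[OF sym_arcs])
  then have "v \<in> W"
  proof (induction rule: reachable_induct)
    case base
    show ?case by (rule u)
  next
    case (step x y)
    with neg show ?case using adj_in_verts by blast
  qed
  with v show False by simp
qed

lemma out_degree_induce:
  assumes "x \<in> X"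
  shows "out_degree (G \<restriction> X) x = card {y \<in> X. x \<rightarrow>\<^bsub>G\<^esub> y}"
proof -
  have "bij_betw (head G) (out_arcs (G \<restriction> X) x) {y \<in> X. x \<rightarrow>\<^bsub>G\<^esub> y}"
    unfolding bij_betw_def
  proof
    show "inj_on (head G) (out_arcs (G \<restriction> X) x)"
      by (auto intro!: inj_onI no_multi_arcs simp: arc_to_ends_def induce_subgraph_def out_arcs_def)
    show "head G ` out_arcs (G \<restriction> X) x = {y \<in> X. x \<rightarrow>\<^bsub>G\<^esub> y}"
      using assms by (force simp: arcs_ends_conv induce_subgraph_def out_arcs_def)
  qed
  then show ?thesis unfolding out_degree_def by (rule bij_betw_same_card)
qed

text \<open>Removing leaves keeps the graph induced and connected. A connected core with two or more
  vertices has no isolated vertex, and it has no leaf by construction. The size hypothesis also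
  rules out trees, whose core is empty.\<close>

lemma two_core_subset_and_degree:
  assumes conn: "Digraph_Component.connected G" and "card (verts (two_core G)) \<ge> 2"
  shows "verts (two_core G) \<subseteq> verts G"
    and "x \<in> verts (two_core G) \<Longrightarrow> 2 \<le> card {y \<in> verts (two_core G). x \<rightarrow>\<^bsub>G\<^esub> y}"
proof -
  define cut where "cut U \<longleftrightarrow> (\<forall>W. W \<noteq> {} \<and> W \<subset> U \<longrightarrow> (\<exists>a\<in>W. \<exists>b\<in>U - W. a \<rightarrow>\<^bsub>G\<^esub> b))" for U
  define Inv where "Inv H \<longleftrightarrow> H = G \<restriction> verts H \<and> verts H \<subseteq> verts G \<and> cut (verts H)" for H
  have nt: "\<not> undirected_tree G" using assms(2) by (auto simp: two_core_def)
  have "Inv (while (\<lambda>H. leaves H \<noteq> {}) (\<lambda>H. H \<restriction> (verts H - leaves H)) G)"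
  proof (rule while_rule[where P = Inv and r = "Wellfounded.measure (\<lambda>H. card (verts H))"])
    have "G = G \<restriction> verts G" by (intro pre_digraph.equality) auto
    then show "Inv G" unfolding Inv_def cut_def using connected_cut[OF conn] by blast
  next
    fix H assume H: "Inv H" "leaves H \<noteq> {}"
    define U where "U = verts H"
    define L where "L = leaves H"
    have HG: "H = G \<restriction> U" and U: "U \<subseteq> verts G" and cutU: "cut U"
      using H(1) unfolding Inv_def U_def by blast+
    have finU: "finite U" using U finite_verts by (rule finite_subset)
    have L: "L = {x \<in> U. card {y \<in> U. x \<rightarrow>\<^bsub>G\<^esub> y} = 1}"
      unfolding L_def leaves_def U_def[symmetric] by (subst HG) (auto simp: out_degree_induce)
    have uniq: "b = c" if "a \<in> L" "b \<in> U" "c \<in> U" "a \<rightarrow>\<^bsub>G\<^esub> b" "a \<rightarrow>\<^bsub>G\<^esub> c" for a b c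
    proof -
      from that(1) obtain x where x: "{y \<in> U. a \<rightarrow>\<^bsub>G\<^esub> y} = {x}"
        by (auto simp: L card_1_singleton_iff)
      have "b \<in> {x}" "c \<in> {x}" unfolding x[symmetric] using that by auto
      then show ?thesis by simp
    qed
    have "H \<restriction> (U - L) = G \<restriction> (U - L)" by (subst HG) (auto simp: induce_subgraph_def)
    moreover have "cut (U - L)"
      unfolding cut_def
    proof (intro allI impI)
      fix W assume W: "W \<noteq> {} \<and> W \<subset> U - L"
      \<comment> \<open>Adding the leaves that hang on \<open>W\<close> ensures that the crossing
        arc survives: it cannot start at an added leaf, whose only neighbour lies in
        \<open>W\<close>, nor end at a leaf, which would have been added.\<close>
      define W' where "W' = W \<union> {l \<in> L. \<exists>w\<in>W. l \<rightarrow>\<^bsub>G\<^esub> w}"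
      have "W' \<noteq> {} \<and> W' \<subset> U" using W by (auto simp: W'_def L)
      from cutU[unfolded cut_def, rule_format, OF this]
      obtain a b where ab: "a \<in> W'" "b \<in> U - W'" "a \<rightarrow>\<^bsub>G\<^esub> b" by blast
      have aW: "a \<in> W"
      proof (rule ccontr)
        assume "a \<notin> W"
        with ab(1) obtain w where "a \<in> L" "w \<in> W" "a \<rightarrow>\<^bsub>G\<^esub> w" by (auto simp: W'_def)
        with ab W have "w = b" by (intro uniq[of a]) auto
        with \<open>w \<in> W\<close> ab show False by (auto simp: W'_def)
      qed
      have "b \<rightarrow>\<^bsub>G\<^esub> a" using ab(3) by (simp only: adj_commute)
      then have "b \<notin> L" using ab aW by (auto simp: W'_def)
      with ab aW show "\<exists>a\<in>W. \<exists>b\<in>U - L - W. a \<rightarrow>\<^bsub>G\<^esub> b" by (auto simp: W'_def)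
    qed
    moreover have "verts H - leaves H = U - L" by (simp add: U_def L_def)
    ultimately show "Inv (H \<restriction> (verts H - leaves H))"
      using U by (auto simp: Inv_def)
    have "U - L \<subset> U" using H(2) by (auto simp: L L_def[symmetric])
    with finU show "(H \<restriction> (verts H - leaves H), H) \<in> Wellfounded.measure (\<lambda>H. card (verts H))"
      by (simp add: psubset_card_mono U_def L_def)
  qed auto
  with nt have inv: "Inv (two_core G)" by (simp add: two_core_def)
  define U where "U = verts (two_core G)"
  have HG: "two_core G = G \<restriction> U" and U: "U \<subseteq> verts G" and cutU: "cut U"
    using inv unfolding Inv_def U_def by blast+
  show "verts (two_core G) \<subseteq> verts G" using U by (simp add: U_def)
  assume x: "x \<in> verts (two_core G)"
  \<comment> \<open>The cut around the single vertex \<open>x\<close> supplies a neighbour in the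
    core.\<close>
  then have "{x} \<subset> U" using assms(2) by (cases "U = {x}") (auto simp: U_def)
  with cutU[unfolded cut_def, rule_format, of "{x}"]
  obtain b where b: "b \<in> U" "x \<rightarrow>\<^bsub>G\<^esub> b" by auto
  have finU: "finite U" using U finite_verts by (rule finite_subset)
  have "x \<notin> leaves (two_core G)" using leaves_two_core[of G] by simp
  then have "card {y \<in> U. x \<rightarrow>\<^bsub>G\<^esub> y} \<noteq> 1"
    using x out_degree_induce[of x U] by (auto simp: leaves_def HG U_def[symmetric])
  moreover have "card {y \<in> U. x \<rightarrow>\<^bsub>G\<^esub> y} \<noteq> 0" using b finU by auto
  ultimately show "2 \<le> card {y \<in> verts (two_core G). x \<rightarrow>\<^bsub>G\<^esub> y}" by (simp add: U_def)
qed

lemma out_degree_pos: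
  assumes conn: "Digraph_Component.connected G" and "card (verts G) \<ge> 2" and x: "x \<in> verts G"
  shows "out_degree G x > 0"
proof -
  have "{x} \<subset> verts G" using assms by (cases "verts G = {x}") auto
  with connected_cut[OF conn, of "{x}"] obtain b where "b \<in> verts G" "x \<rightarrow>\<^bsub>G\<^esub> b" by blast
  then show ?thesis by (auto simp: out_degree_eq_card_nbrs card_gt_0_iff)
qed

section \<open>The Markov matrix: powers, traces and eigenvalue bound\<close>

lemma srw_matrix_pow_entry:
  fixes k :: nat
  defines "A \<equiv> map_mat complex_of_real (markov_matrix G)"
  assumes "i < card (verts G)" "j < card (verts G)"
  shows "(A ^\<^sub>m k) $$ (i, j) =
    complex_of_real (kpow (verts G) (markov_kernel G) k (from_nat_into (verts G) i) (from_nat_into (verts G) j))"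
  using assms(2,3)
proof (induction k arbitrary: j)
  case 0
  have "bij_betw (from_nat_into (verts G)) {..<card (verts G)} (verts G)"
    by (rule bij_betw_from_nat_into_finite) simp
  then have "inj_on (from_nat_into (verts G)) {..<card (verts G)}" by (rule bij_betw_imp_inj_on)
  then show ?case using 0 by (auto simp: A_def markov_matrix_def inj_on_eq_iff)
next
  case (Suc k)
  let ?v = "from_nat_into (verts G)" and ?N = "card (verts G)"
  have bij: "bij_betw ?v {..<?N} (verts G)" by (rule bij_betw_from_nat_into_finite) simp
  have v: "?v l \<in> verts G" if "l < ?N" for l using bij that by (auto simp: bij_betw_def)
  have A: "A \<in> carrier_mat ?N ?N" by (simp add: A_def markov_matrix_def)
  have "(A ^\<^sub>m Suc k) $$ (i, j) = (\<Sum>l<?N. (A ^\<^sub>m k) $$ (i, l) * A $$ (l, j))"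
    using Suc.prems A by (simp add: scalar_prod_def lessThan_atLeast0)
  also have "\<dots> = (\<Sum>l<?N. complex_of_real (kpow (verts G) (markov_kernel G) k (?v i) (?v l)
      * markov_kernel G (?v l) (?v j)))"
    using Suc.prems Suc.IH by (intro sum.cong refl) (simp add: A_def markov_matrix_def)
  also have "\<dots> = complex_of_real (\<Sum>z\<in>verts G. kpow (verts G) (markov_kernel G) k (?v i) z
      * markov_kernel G z (?v j))"
    unfolding of_real_sum by (rule sum.reindex_bij_betw[OF bij])
  \<comment> \<open>The matrix power appends a last step while \<open>kpow\<close> peels off the
    first one; \<open>kpow_add\<close> reconciles the two recursions.\<close>
  also have "(\<Sum>z\<in>verts G. kpow (verts G) (markov_kernel G) k (?v i) z * markov_kernel G z (?v j))
      = (\<Sum>z\<in>verts G. kpow (verts G) (markov_kernel G) k (?v i) z * kpow (verts G) (markov_kernel G) (Suc 0) z (?v j))"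
    using v[OF Suc.prems(2)] by (simp add: kpow_1 del: kpow.simps)
  also have "\<dots> = kpow (verts G) (markov_kernel G) (k + Suc 0) (?v i) (?v j)"
    by (rule kpow_add[symmetric]) (use v Suc.prems in auto)
  finally show ?case by simp
qed

lemma mat_trace_srw_matrix_pow:
  "mat_trace (map_mat complex_of_real (markov_matrix G) ^\<^sub>m k) =
    complex_of_real (\<Sum>x\<in>verts G. kpow (verts G) (markov_kernel G) k x x)"
proof -
  let ?v = "from_nat_into (verts G)" and ?N = "card (verts G)"
  have bij: "bij_betw ?v {..<?N} (verts G)" by (rule bij_betw_from_nat_into_finite) simp
  have dim: "dim_row (map_mat complex_of_real (markov_matrix G) ^\<^sub>m k) = ?N"
    by (simp add: markov_matrix_def)
  have "mat_trace (map_mat complex_of_real (markov_matrix G) ^\<^sub>m k)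
      = (\<Sum>i<?N. complex_of_real (kpow (verts G) (markov_kernel G) k (?v i) (?v i)))"
    unfolding mat_trace_def dim by (intro sum.cong refl srw_matrix_pow_entry) auto
  also have "\<dots> = (\<Sum>x\<in>verts G. complex_of_real (kpow (verts G) (markov_kernel G) k x x))"
    by (rule sum.reindex_bij_betw[OF bij])
  finally show ?thesis by simp
qed

lemma srw_eigenvalue_le_1:
  assumes "eigenvalue (map_mat complex_of_real (markov_matrix G)) z"
  shows "cmod z \<le> 1"
proof (rule eigenvalue_stochastic_le_1)
  let ?v = "from_nat_into (verts G)" and ?N = "card (verts G)"
  have bij: "bij_betw ?v {..<?N} (verts G)" by (rule bij_betw_from_nat_into_finite) simp
  fix i assume i: "i < ?N"
  have "(\<Sum>j<?N. cmod (map_mat complex_of_real (markov_matrix G) $$ (i, j)))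
      = (\<Sum>j<?N. markov_kernel G (?v i) (?v j))"
    using i by (intro sum.cong refl) (auto simp: markov_matrix_def markov_kernel_def)
  also have "\<dots> = (\<Sum>y\<in>verts G. markov_kernel G (?v i) y)" by (rule sum.reindex_bij_betw[OF bij])
  also have "\<dots> = real (card {y \<in> verts G. ?v i \<rightarrow>\<^bsub>G\<^esub> y}) * (1 / real (out_degree G (?v i)))"
    unfolding markov_kernel_def by (subst sum.inter_filter[symmetric]) auto
  also have "\<dots> \<le> 1" by (simp add: out_degree_eq_card_nbrs)
  finally show "(\<Sum>j<?N. cmod (map_mat complex_of_real (markov_matrix G) $$ (i, j))) \<le> 1" .
qed (use assms in \<open>auto simp: markov_matrix_def\<close>)

section \<open>From the core to the claimed radius\<close>

lemma core_graph_two_core: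
  assumes "Digraph_Component.connected G" "card (verts (two_core G)) \<ge> 2"
  shows "core_graph (verts G) (verts (two_core G)) (dominates G)"
  by unfold_locales (use two_core_subset_and_degree[OF assms] adj_commute in auto)

definition core_degree :: "'a \<Rightarrow> real" where
  "core_degree x = real (card {y \<in> verts (two_core G). x \<rightarrow>\<^bsub>G\<^esub> y})"

text \<open>This is \<open>\<rho>\<close> of \<open>return_sum_ge\<close>: the claimed radius with
  core vertices and core degrees in place of all vertices and degrees, except for one factor of each
  squared degree.\<close>

definition core_bound :: real where
  "core_bound = (let D = \<Sum>x\<in>verts (two_core G). core_degree x in
    2 * sqrt (D / card (verts (two_core G)) - 1)
      / ((\<Sum>x\<in>verts (two_core G). core_degree x * real (out_degree G x)) / D))"

lemma card_arcs_pos: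
  assumes conn: "Digraph_Component.connected G" and "card (verts G) \<ge> 2"
    and \<Delta>: "\<And>v. v \<in> verts G \<Longrightarrow> out_degree G v \<le> \<Delta>"
  shows "\<Delta> \<ge> 1" "card (verts G) \<le> 2 * card (edges G)"
    "2 * real (card (edges G)) \<le> (\<Sum>v\<in>verts G. (real (out_degree G v))\<^sup>2)"
    "2 * card (edges G) \<le> \<Delta> * card (verts G)"
proof -
  have pos: "1 \<le> out_degree G v" if "v \<in> verts G" for v
    using out_degree_pos[OF conn assms(2) that] by simp
  obtain v where "v \<in> verts G" using assms(2) by fastforce
  with pos \<Delta> show "\<Delta> \<ge> 1" by (meson le_trans)
  show "card (verts G) \<le> 2 * card (edges G)"
    unfolding handshake using sum_mono[of "verts G" "\<lambda>_. 1" "out_degree G"] pos by simp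
  show "2 * card (edges G) \<le> \<Delta> * card (verts G)"
    unfolding handshake using sum_mono[of "verts G" "out_degree G" "\<lambda>_. \<Delta>"] \<Delta> by (simp add: mult.commute)
  have "2 * real (card (edges G)) = (\<Sum>v\<in>verts G. real (out_degree G v))"
    using handshake by (metis of_nat_mult of_nat_numeral of_nat_sum)
  also have "\<dots> \<le> (\<Sum>v\<in>verts G. (real (out_degree G v))\<^sup>2)"
    using pos by (intro sum_mono self_le_power) auto
  finally show "2 * real (card (edges G)) \<le> (\<Sum>v\<in>verts G. (real (out_degree G v))\<^sup>2)" .
qed

text \<open>The trace of the power \<open>2 ^ p\<close> is bounded below by nonbacktracking walks in
  the core and above by splitting the spectrum at \<open>t\<close>.\<close>

lemma srw_measure_ge_core:
  assumes conn: "Digraph_Component.connected G" and core: "card (verts (two_core G)) \<ge> 2"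
    and \<Delta>: "\<And>v. v \<in> verts G \<Longrightarrow> out_degree G v \<le> \<Delta>" and "t \<ge> 0" "0 < p"
  shows "(real r / real (Suc r) * core_bound) ^ (2 ^ p) * real (card (verts (two_core G)))
    \<le> (real (Suc r * \<Delta> ^ Suc r))\<^sup>2 * (real (card (verts G)) *
        (measure_pmf.prob (srw_measure G) {z. cmod z > t} + t ^ (2 ^ p)))"
proof -
  define U where "U = verts (two_core G)"
  interpret C: core_graph "verts G" U "dominates G"
    unfolding U_def by (rule core_graph_two_core[OF conn core])
  have N: "card (verts G) \<ge> 2"
    using core card_mono[OF finite_verts C.U_subset] by (simp add: U_def)
  have deg: "C.deg x = out_degree G x" for x by (simp add: C.deg_def out_degree_eq_card_nbrs)
  have cdeg: "real (C.cdeg x) = core_degree x" for x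
    unfolding core_degree_def U_def[symmetric] by (simp add: C.cdeg_def C.cnbrs_def)
  have bound: "core_bound = 2 * sqrt (C.narcs / card U - 1)
      / ((\<Sum>x\<in>U. real (C.cdeg x) * real (C.deg x)) / C.narcs)"
    unfolding core_bound_def U_def[symmetric] by (simp add: Let_def C.narcs_def cdeg deg)
  have K: "markov_kernel G = (\<lambda>x y. if x \<rightarrow>\<^bsub>G\<^esub> y then 1 / real (C.deg x) else 0)"
    by (intro ext) (simp add: markov_kernel_def deg)
  have pos: "0 < C.deg x" if "x \<in> verts G" for x
    unfolding deg by (rule out_degree_pos[OF conn N that])
  have diag: "kpow (verts G) (markov_kernel G) k x x = kpow (verts G) C.nadj k x x"
    if "x \<in> verts G" for k x
    using C.kpow_walk_eq[OF pos that, of k x] pos[OF that] unfolding K by simp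
  have "(\<Sum>x\<in>verts G. kpow (verts G) C.nadj (2 ^ p) x x)
      = (\<Sum>x\<in>verts G. kpow (verts G) (markov_kernel G) (2 ^ p) x x)"
    by (intro sum.cong refl) (simp add: diag)
  also have "\<dots> \<le> cmod (complex_of_real \<dots>)"
    unfolding norm_of_real by (rule abs_ge_self)
  also have "\<dots> \<le> real (card (verts G)) *
      (measure_pmf.prob (srw_measure G) {z. cmod z > t} + t ^ (2 ^ p))"
    unfolding mat_trace_srw_matrix_pow[symmetric] srw_measure_def
    by (rule mat_trace_pow_le_spectral_measure) (use N \<open>t \<ge> 0\<close> srw_eigenvalue_le_1 in \<open>auto simp: markov_matrix_def\<close>)
  finally have traces: "(\<Sum>x\<in>verts G. kpow (verts G) C.nadj (2 ^ p) x x) \<le> \<dots>" .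
  have "C.cdeg x \<le> \<Delta>" if "x \<in> U" for x
    using C.cdeg_le_deg[of x] \<Delta>[of x] that C.U_subset by (auto simp: deg)
  moreover have "\<Delta> \<ge> 1" by (rule card_arcs_pos(1)[OF conn N \<Delta>])
  moreover have "U \<noteq> {}" using core by (auto simp: U_def)
  ultimately have "(real r / real (Suc r) * core_bound) ^ (2 ^ p) * real (card U)
      \<le> (real (Suc r * \<Delta> ^ Suc r))\<^sup>2 * (\<Sum>x\<in>verts G. kpow (verts G) C.nadj (2 ^ p) x x)"
    unfolding bound using \<open>0 < p\<close> by (intro C.return_sum_ge)
  also have "\<dots> \<le> (real (Suc r * \<Delta> ^ Suc r))\<^sup>2 * (real (card (verts G)) *
        (measure_pmf.prob (srw_measure G) {z. cmod z > t} + t ^ (2 ^ p)))"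
    by (intro mult_left_mono traces) simp
  finally show ?thesis by (simp add: U_def)
qed

text \<open>An abbreviation, so that its instance at each graph is literally the expression in the
  theorem.\<close>

abbreviation srw_radius :: real where
  "srw_radius \<equiv> 2 * sqrt (avg_degree G - 1) /
    (1 / (2 * real (card (edges G))) * (\<Sum>v\<in>verts G. (real (out_degree G v))\<^sup>2))"

text \<open>Passing to the core loses at most \<open>y * N\<close> arcs, with \<open>N\<close> the
  number of vertices. This costs at most \<open>sqrt y\<close> in the root and \<open>y\<close> in
  the quotient of arcs by squared degrees.\<close>

lemma srw_radius_bounds:
  assumes conn: "Digraph_Component.connected G" and core: "card (verts (two_core G)) \<ge> 2"
    and \<Delta>: "\<And>v. v \<in> verts G \<Longrightarrow> out_degree G v \<le> \<Delta>"
  defines "y \<equiv> 2 * real \<Delta> * (1 - real (card (verts (two_core G))) / real (card (verts G)))"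
  shows "srw_radius \<le> 2 * real \<Delta>" "srw_radius \<le> core_bound + 2 * sqrt y + 2 * real \<Delta> * y"
proof -
  define U where "U = verts (two_core G)"
  define N where "N = real (card (verts G))"
  define n where "n = real (card U)"
  define E where "E = 2 * real (card (edges G))"
  define B where "B = (\<Sum>v\<in>verts G. (real (out_degree G v))\<^sup>2)"
  define D where "D = (\<Sum>x\<in>U. core_degree x)"
  define BU where "BU = (\<Sum>x\<in>U. core_degree x * real (out_degree G x))"
  define a where "a = sqrt (avg_degree G - 1)"
  define s where "s = sqrt (D / n - 1)"
  interpret C: core_graph "verts G" U "dominates G"
    unfolding U_def by (rule core_graph_two_core[OF conn core])
  have n2: "n \<ge> 2" using core by (simp add: n_def U_def)
  have nN: "n \<le> N" using card_mono[OF finite_verts C.U_subset] by (simp add: n_def N_def)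
  then have N: "card (verts G) \<ge> 2" using n2 by (simp add: N_def)
  have \<Delta>1: "real \<Delta> \<ge> 1" using card_arcs_pos(1)[OF conn N \<Delta>] by simp
  have NE: "N \<le> E" using card_arcs_pos(2)[OF conn N \<Delta>] unfolding N_def E_def by linarith
  have EB: "E \<le> B" using card_arcs_pos(3)[OF conn N \<Delta>] by (simp add: E_def B_def)
  have E\<Delta>: "E \<le> real \<Delta> * N" using card_arcs_pos(4)[OF conn N \<Delta>] unfolding N_def E_def
    by (metis of_nat_le_iff of_nat_mult of_nat_numeral)
  have N0: "N > 0" "E > 0" "B > 0" using nN n2 NE EB by linarith+
  have avg: "avg_degree G = E / N" by (simp add: avg_degree_def E_def N_def)
  have a0: "a \<ge> 0" using NE N0 by (simp add: a_def avg)
  have aD: "a \<le> real \<Delta>"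
  proof -
    have "E / N \<le> real \<Delta>" using E\<Delta> N0 by (simp add: field_simps)
    also have "\<dots> \<le> (real \<Delta>)\<^sup>2" using \<Delta>1 by (intro self_le_power) auto
    finally show ?thesis unfolding a_def avg by (intro real_le_lsqrt) auto
  qed
  have tgt: "srw_radius = 2 * (a * (E / B))" by (simp add: a_def E_def B_def)
  have "a * (E / B) \<le> real \<Delta> * 1" using aD EB N0 by (intro mult_mono) auto
  then show "srw_radius \<le> 2 * real \<Delta>" unfolding tgt by simp
  have y: "y = 2 * real \<Delta> * (1 - n / N)" by (simp add: y_def n_def N_def U_def)
  have y0: "y \<ge> 0" unfolding y using nN N0 by simp
  \<comment> \<open>Each vertex outside the core accounts for at most \<Delta> arcs out of it and
    \<Delta> arcs into it, hence the factor 2.\<close>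
  have yN: "y * N = 2 * real \<Delta> * (N - n)" unfolding y using N0 by (simp add: field_simps)
  have dU: "core_degree x + real (card {z \<in> verts G - U. x \<rightarrow>\<^bsub>G\<^esub> z}) = real (out_degree G x)" for x
  proof -
    have "{z \<in> verts G. x \<rightarrow>\<^bsub>G\<^esub> z} = {z \<in> U. x \<rightarrow>\<^bsub>G\<^esub> z} \<union> {z \<in> verts G - U. x \<rightarrow>\<^bsub>G\<^esub> z}"
      using C.U_subset by auto
    then have "out_degree G x = card {z \<in> U. x \<rightarrow>\<^bsub>G\<^esub> z} + card {z \<in> verts G - U. x \<rightarrow>\<^bsub>G\<^esub> z}"
      unfolding out_degree_eq_card_nbrs by (subst card_Un_disjoint[symmetric]) auto
    then show ?thesis by (simp add: core_degree_def U_def)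
  qed
  have cle: "core_degree x \<le> real (out_degree G x)" for x using dU[of x] by linarith
  have c2: "core_degree x \<ge> 2" if "x \<in> U" for x
    using C.core[OF that] by (simp add: core_degree_def U_def)
  have D2: "D \<ge> 2 * n"
    using sum_mono[of U "\<lambda>_. 2" core_degree] c2 by (simp add: D_def n_def mult.commute)
  then have D0: "D > 0" using n2 by linarith
  have Esum: "E = (\<Sum>v\<in>verts G. real (out_degree G v))"
    unfolding E_def using handshake by (metis of_nat_mult of_nat_numeral of_nat_sum)
  have Esplit: "E = (\<Sum>v\<in>U. real (out_degree G v)) + (\<Sum>v\<in>verts G - U. real (out_degree G v))"
    unfolding Esum using C.U_subset by (subst sum.subset_diff[of U]) auto
  have out: "(\<Sum>v\<in>verts G - U. real (out_degree G v)) \<le> real \<Delta> * (N - n)"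
  proof -
    have "real (card (verts G - U)) = N - n"
      using card_Diff_subset[OF C.finite_U C.U_subset] nN by (simp add: N_def n_def of_nat_diff)
    then show ?thesis
      using sum_mono[of "verts G - U" "\<lambda>v. real (out_degree G v)" "\<lambda>_. real \<Delta>"] \<Delta>
      by (simp add: mult.commute)
  qed
  \<comment> \<open>The arcs leaving the core are counted from their outer ends, where the degree
    bound applies to only \<open>N - n\<close> vertices.\<close>
  have "(\<Sum>x\<in>U. real (card {z \<in> verts G - U. x \<rightarrow>\<^bsub>G\<^esub> z}))
      = (\<Sum>x\<in>U. \<Sum>z\<in>verts G - U. of_bool (x \<rightarrow>\<^bsub>G\<^esub> z))"
    by (intro sum.cong refl) (simp add: of_bool_def sum.inter_filter[symmetric])
  also have "\<dots> = (\<Sum>z\<in>verts G - U. \<Sum>x\<in>U. of_bool (x \<rightarrow>\<^bsub>G\<^esub> z))" by (rule sum.swap)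
  also have "\<dots> = (\<Sum>z\<in>verts G - U. core_degree z)"
    unfolding core_degree_def U_def[symmetric]
    by (intro sum.cong refl) (simp add: of_bool_def sum.inter_filter[symmetric] adj_commute)
  also have "\<dots> \<le> (\<Sum>z\<in>verts G - U. real (out_degree G z))" by (intro sum_mono cle)
  finally have cross: "(\<Sum>x\<in>U. real (card {z \<in> verts G - U. x \<rightarrow>\<^bsub>G\<^esub> z})) \<le> real \<Delta> * (N - n)"
    using out by linarith
  have "(\<Sum>v\<in>U. real (out_degree G v)) = D + (\<Sum>x\<in>U. real (card {z \<in> verts G - U. x \<rightarrow>\<^bsub>G\<^esub> z}))"
    unfolding D_def sum.distrib[symmetric] by (intro sum.cong refl) (simp only: dU)
  then have ED: "E - y * N \<le> D" using Esplit out cross yN by linarith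
  have DE: "D \<le> E"
  proof -
    have "D \<le> (\<Sum>v\<in>U. real (out_degree G v))" unfolding D_def by (intro sum_mono cle)
    also have "\<dots> \<le> E" unfolding Esplit by (simp add: sum_nonneg)
    finally show ?thesis .
  qed
  have BUB: "BU \<le> B"
  proof -
    have "BU \<le> (\<Sum>x\<in>U. (real (out_degree G x))\<^sup>2)"
      unfolding BU_def power2_eq_square by (intro sum_mono mult_right_mono cle) auto
    also have "\<dots> \<le> B" unfolding B_def using C.U_subset by (intro sum_mono2) auto
    finally show ?thesis .
  qed
  have "D \<le> BU" unfolding D_def BU_def
  proof (intro sum_mono)
    fix x assume "x \<in> U"
    then show "core_degree x \<le> core_degree x * real (out_degree G x)"
      using c2[of x] cle[of x] by (simp add: mult_le_cancel_left1)
  qed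
  with D0 have BU0: "BU > 0" by linarith
  have s0: "s \<ge> 0" unfolding s_def using D2 n2 by (simp add: field_simps)
  have as: "a - sqrt y \<le> s"
  proof -
    have "E / N - y = (E - y * N) / N" using N0 by (simp add: field_simps)
    also have "\<dots> \<le> D / N" using ED N0 by (intro divide_right_mono) auto
    also have "\<dots> \<le> D / n" using nN n2 D0 by (intro divide_left_mono) auto
    finally have "E / N - 1 \<le> (D / n - 1) + y" by simp
    then have "a \<le> sqrt ((D / n - 1) + y)" unfolding a_def avg by simp
    also have "\<dots> \<le> s + sqrt y" unfolding s_def
      using y0 D2 n2 by (intro sqrt_add_le_add_sqrt) (auto simp: field_simps)
    finally show ?thesis by simp
  qed
  have eb: "E / B - y \<le> D / B"
  proof -
    have "E / B - y \<le> E / B - y * (N / B)"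
      using y0 NE EB N0 mult_left_mono[of "N / B" 1 y] by simp
    also have "\<dots> = (E - y * N) / B" by (simp add: diff_divide_distrib)
    also have "\<dots> \<le> D / B" using ED N0 by (intro divide_right_mono) auto
    finally show ?thesis .
  qed
  have DB: "D / B \<le> 1" "D / B \<ge> 0" using DE EB N0 D0 by auto
  \<comment> \<open>The difference \<open>a - sqrt y\<close> may be negative, so it is only
    multiplied by the nonnegative \<open>D / B\<close>; the denominator is replaced by
    \<open>BU\<close> after \<open>s\<close>, known to be nonnegative, has taken its place.\<close>
  have "a * (E / B) - a * y - sqrt y \<le> a * (D / B) - sqrt y * (D / B)"
    using mult_left_mono[OF eb a0] mult_left_mono[OF DB(1), of "sqrt y"] y0
    by (simp add: algebra_simps)
  also have "\<dots> = (a - sqrt y) * (D / B)" by (simp add: algebra_simps)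
  also have "\<dots> \<le> s * (D / B)" using as DB by (intro mult_right_mono) auto
  also have "\<dots> \<le> s * (D / BU)"
    using BUB BU0 D0 s0 N0 by (intro mult_left_mono divide_left_mono) auto
  finally have "srw_radius \<le> 2 * (s * (D / BU)) + 2 * sqrt y + 2 * (a * y)"
    unfolding tgt by linarith
  also have "2 * (s * (D / BU)) = core_bound"
    by (simp add: core_bound_def Let_def s_def D_def BU_def U_def n_def)
  finally show "srw_radius \<le> core_bound + 2 * sqrt y + 2 * real \<Delta> * y"
    using mult_right_mono[OF aD y0] by linarith
qed

text \<open>Error budget: \<epsilon>/4 is lost to the core and \<epsilon>/4 to the factor
  \<open>r / (r + 1)\<close>, so the trace grows at rate at least the radius minus \<epsilon>/2,
  while small eigenvalues only reach the radius minus \<epsilon>. The power \<open>2 ^ p\<close>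
  amplifies this gap until it beats the constant \<open>c\<close>.\<close>

lemma srw_measure_ge:
  fixes r p \<Delta> :: nat and \<epsilon> :: real
  assumes conn: "Digraph_Component.connected G" and core: "card (verts (two_core G)) \<ge> 2"
    and \<Delta>: "\<And>v. v \<in> verts G \<Longrightarrow> out_degree G v \<le> \<Delta>"
    and \<epsilon>: "\<epsilon> > 0" and p: "0 < p"
    and half: "real (card (verts (two_core G))) \<ge> real (card (verts G)) / 2"
  defines "y \<equiv> 2 * real \<Delta> * (1 - real (card (verts (two_core G))) / real (card (verts G)))"
    and "c \<equiv> (real (Suc r * \<Delta> ^ Suc r))\<^sup>2"
  assumes err: "2 * sqrt y + 2 * real \<Delta> * y \<le> \<epsilon> / 4"
    and r: "8 * real \<Delta> \<le> \<epsilon> * real (Suc r)"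
    and q: "(4 * real \<Delta> / (4 * real \<Delta> + \<epsilon>)) ^ (2 ^ p) \<le> 1 / (4 * c)"
  shows "min 1 ((\<epsilon> / 2) ^ (2 ^ p) / (4 * c))
    \<le> measure_pmf.prob (srw_measure G) {z. cmod z > srw_radius - \<epsilon>}"
proof (cases "srw_radius < \<epsilon>")
  \<comment> \<open>The threshold is negative and the event is everything; this is the reason for
    the \<open>1\<close> in \<open>min\<close>.\<close>
  case True
  then have "{z :: complex. cmod z > srw_radius - \<epsilon>} = UNIV"
    by (auto intro: order.strict_trans2[OF _ norm_ge_zero])
  then show ?thesis by simp
next
  case False
  define \<rho> where "\<rho> = srw_radius"
  define \<delta> where "\<delta> = measure_pmf.prob (srw_measure G) {z. cmod z > \<rho> - \<epsilon>}"
  define m where "m = (2::nat) ^ p"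
  define N where "N = real (card (verts G))"
  define R where "R = real r / real (Suc r) * core_bound"
  have sub: "verts (two_core G) \<subseteq> verts G" by (rule two_core_subset_and_degree(1)[OF conn core])
  have N2: "card (verts G) \<ge> 2" using core card_mono[OF finite_verts sub] by linarith
  then have N: "N > 0" by (simp add: N_def)
  have \<Delta>1: "\<Delta> \<ge> 1" by (rule card_arcs_pos(1)[OF conn N2 \<Delta>])
  then have "real (Suc r * \<Delta> ^ Suc r) > 0"
    unfolding of_nat_0_less_iff by (intro mult_pos_pos zero_less_power) auto
  then have c: "c > 0" unfolding c_def by (rule zero_less_power)
  have \<rho>: "\<epsilon> \<le> \<rho>" "\<rho> \<le> 2 * real \<Delta>" "\<rho> - \<epsilon> / 4 \<le> core_bound"
    using False srw_radius_bounds[OF conn core \<Delta>] err unfolding \<rho>_def y_def by linarith+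
  have R: "\<rho> - \<epsilon> / 2 \<le> R"
  proof -
    have "(\<rho> - \<epsilon> / 4) / real (Suc r) \<le> \<epsilon> / 4"
      using r \<rho> \<epsilon> by (simp add: divide_le_eq)
    then have "\<rho> - \<epsilon> / 2 \<le> (\<rho> - \<epsilon> / 4) - (\<rho> - \<epsilon> / 4) / real (Suc r)" by linarith
    also have "\<dots> = real r / real (Suc r) * (\<rho> - \<epsilon> / 4)" by (simp add: field_simps)
    also have "\<dots> \<le> R" unfolding R_def using \<rho> by (intro mult_left_mono) auto
    finally show ?thesis .
  qed
  have h0: "\<rho> - \<epsilon> / 2 > 0" using \<rho> \<epsilon> by linarith
  have "(\<rho> - \<epsilon> / 2) ^ m * (N / 2) \<le> R ^ m * real (card (verts (two_core G)))"
    using R h0 half N by (intro mult_mono power_mono) (auto simp: N_def)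
  also have "\<dots> \<le> c * (N * (\<delta> + (\<rho> - \<epsilon>) ^ m))"
    unfolding R_def c_def N_def \<delta>_def m_def
    by (rule srw_measure_ge_core[OF conn core \<Delta> _ p]) (use \<rho> in auto)
  finally have "N * ((\<rho> - \<epsilon> / 2) ^ m) \<le> N * (2 * c * (\<delta> + (\<rho> - \<epsilon>) ^ m))"
    by (simp add: mult_ac)
  then have "(\<rho> - \<epsilon> / 2) ^ m \<le> 2 * c * (\<delta> + (\<rho> - \<epsilon>) ^ m)" using N by simp
  then have 1: "(\<rho> - \<epsilon> / 2) ^ m / (2 * c) \<le> \<delta> + (\<rho> - \<epsilon>) ^ m"
    using c by (simp add: divide_le_eq mult_ac)
  \<comment> \<open>The ratio of the two rates is below 1 uniformly over all graphs, because \<rho>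
    is at most \<open>2 * real \<Delta>\<close>.\<close>
  have "\<rho> - \<epsilon> \<le> 4 * real \<Delta> / (4 * real \<Delta> + \<epsilon>) * (\<rho> - \<epsilon> / 2)"
  proof -
    define d where "d = 4 * real \<Delta> + \<epsilon>"
    define w where "w = \<epsilon> * (\<rho> - \<epsilon> / 2) / d"
    have d: "d > 0" using \<epsilon> by (simp add: d_def)
    have "2 * (\<rho> - \<epsilon> / 2) \<le> d" using \<rho> \<epsilon> by (simp add: d_def)
    then have "\<epsilon> * (2 * (\<rho> - \<epsilon> / 2)) \<le> \<epsilon> * d" using \<epsilon> by (intro mult_left_mono) auto
    then have "w \<le> \<epsilon> / 2" using d by (simp add: w_def divide_le_eq algebra_simps)
    then have "\<rho> - \<epsilon> \<le> (\<rho> - \<epsilon> / 2) - w" by linarith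
    also have "\<dots> = (d - \<epsilon>) / d * (\<rho> - \<epsilon> / 2)" using d by (simp add: w_def field_simps)
    finally show ?thesis by (simp add: d_def)
  qed
  then have "(\<rho> - \<epsilon>) ^ m \<le> (4 * real \<Delta> / (4 * real \<Delta> + \<epsilon>) * (\<rho> - \<epsilon> / 2)) ^ m"
    using \<rho>(1) by (intro power_mono) auto
  also have "\<dots> = (4 * real \<Delta> / (4 * real \<Delta> + \<epsilon>)) ^ m * (\<rho> - \<epsilon> / 2) ^ m"
    by (rule power_mult_distrib)
  also have "\<dots> \<le> 1 / (4 * c) * (\<rho> - \<epsilon> / 2) ^ m"
    using q h0 by (intro mult_right_mono) (auto simp: m_def)
  finally have "(\<rho> - \<epsilon> / 2) ^ m / (4 * c) \<le> \<delta>" using 1 c by (simp add: field_simps)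
  \<comment> \<open>Since \<open>\<epsilon> \<le> \<rho>\<close> in this case, the bound can be
    freed from the graph.\<close>
  moreover have "(\<epsilon> / 2) ^ m / (4 * c) \<le> (\<rho> - \<epsilon> / 2) ^ m / (4 * c)"
    using \<rho> \<epsilon> c by (intro divide_right_mono power_mono) auto
  ultimately show ?thesis unfolding \<delta>_def \<rho>_def m_def by linarith
qed

end

text \<open>The constants \<open>r\<close>, \<open>c\<close> and \<open>p\<close> are fixed in this
  order from \<Delta> and \<epsilon> alone. Along the sequence only the core proportion still has to
  come close to 1, and then \<open>srw_measure_ge\<close> bounds the mass below by a fixed positive
  number.\<close>

theorem theorem3:
  fixes G :: "nat \<Rightarrow> ('a, 'b) pre_digraph" and \<Delta> :: nat
  assumes "\<And>n. graph (G n)"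
    and "\<And>n. Digraph_Component.connected (G n)"
    and "\<And>n v. v \<in> verts (G n) \<Longrightarrow> out_degree (G n) v \<le> \<Delta>"
    and "filterlim (\<lambda>n. card (verts (G n))) at_top sequentially"
    and "(\<lambda>n. real (card (verts (two_core (G n)))) / real (card (verts (G n)))) \<longlonglongrightarrow> 1"
  shows "\<forall>\<epsilon>>0. liminf (\<lambda>n. ereal (measure_pmf.prob (srw_measure (G n))
           {x. cmod x >
               2 * sqrt (avg_degree (G n) - 1) /
                 (1 / (2 * real (card (edges (G n)))) *
                    (\<Sum>v\<in>verts (G n). (real (out_degree (G n) v))\<^sup>2)) - \<epsilon>})) > 0"
proof (intro allI impI)
  fix \<epsilon> :: real assume \<epsilon>: "\<epsilon> > 0"
  define N where "N n = real (card (verts (G n)))" for n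
  define u where "u n = real (card (verts (two_core (G n))))" for n
  have u: "(\<lambda>n. u n / N n) \<longlonglongrightarrow> 1" using assms(5) by (simp add: u_def N_def)
  \<comment> \<open>With 4 vertices, a core of at least half the size has the required 2.\<close>
  have large: "eventually (\<lambda>n. card (verts (G n)) \<ge> 4) sequentially"
    using assms(4) by (simp add: filterlim_at_top)
  then obtain n\<^sub>0 where n\<^sub>0: "card (verts (G n\<^sub>0)) \<ge> 4" by (auto simp: eventually_sequentially)
  have \<Delta>1: "\<Delta> \<ge> 1"
    by (rule graph.card_arcs_pos(1)[OF assms(1,2), of n\<^sub>0]) (use n\<^sub>0 assms(3) in auto)
  obtain r where "8 * real \<Delta> / \<epsilon> < real r" using reals_Archimedean2 by blast
  then have r: "8 * real \<Delta> \<le> \<epsilon> * real (Suc r)" using \<epsilon> by (simp add: divide_less_eq algebra_simps)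
  define c where "c = (real (Suc r * \<Delta> ^ Suc r))\<^sup>2"
  have "real (Suc r * \<Delta> ^ Suc r) > 0"
    unfolding of_nat_0_less_iff using \<Delta>1 by (intro mult_pos_pos zero_less_power) auto
  then have c: "c > 0" unfolding c_def by (rule zero_less_power)
  define q where "q = 4 * real \<Delta> / (4 * real \<Delta> + \<epsilon>)"
  have q: "0 \<le> q" "q < 1" using \<epsilon> by (auto simp: q_def)
  obtain k where k: "q ^ k < 1 / (4 * c)" using real_arch_pow_inv[of "1 / (4 * c)" q] q c by auto
  define p where "p = Suc k"
  \<comment> \<open>The exponent must be a power of 2, and passing from \<open>k\<close> to a larger
    one only helps because \<open>q\<close> is below 1.\<close>
  have "q ^ (2 ^ p) \<le> q ^ k"
    using q less_exp[of p] by (intro power_decreasing) (auto simp: p_def)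
  with k have qp: "q ^ (2 ^ p) \<le> 1 / (4 * c)" by linarith
  define \<kappa> where "\<kappa> = min 1 ((\<epsilon> / 2) ^ (2 ^ p) / (4 * c))"
  have \<kappa>: "\<kappa> > 0" using \<epsilon> c by (simp add: \<kappa>_def)
  \<comment> \<open>The loss to the core is continuous in the core proportion and vanishes at
    1.\<close>
  have "(\<lambda>n. 2 * sqrt (2 * real \<Delta> * (1 - u n / N n)) + 2 * real \<Delta> * (2 * real \<Delta> * (1 - u n / N n)))
      \<longlonglongrightarrow> 2 * sqrt (2 * real \<Delta> * (1 - 1)) + 2 * real \<Delta> * (2 * real \<Delta> * (1 - 1))"
    by (intro tendsto_intros u)
  then have "eventually (\<lambda>n. 2 * sqrt (2 * real \<Delta> * (1 - u n / N n))
      + 2 * real \<Delta> * (2 * real \<Delta> * (1 - u n / N n)) < \<epsilon> / 4) sequentially"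
    using \<epsilon> by (intro order_tendstoD(2)) auto
  moreover have "eventually (\<lambda>n. u n / N n > 1 / 2) sequentially"
    by (rule order_tendstoD(1)[OF u]) simp
  ultimately have "eventually (\<lambda>n. \<kappa> \<le> measure_pmf.prob (srw_measure (G n))
      {x. cmod x > graph.srw_radius (G n) - \<epsilon>}) sequentially"
    using large
  proof eventually_elim
    case (elim n)
    have N4: "N n \<ge> 4" using elim(3) by (simp add: N_def)
    have half: "u n \<ge> N n / 2" using elim(2) N4 by (simp add: field_simps)
    then have core: "card (verts (two_core (G n))) \<ge> 2" using N4 by (simp add: u_def)
    show ?case
      unfolding \<kappa>_def c_def
      by (rule graph.srw_measure_ge[OF assms(1,2) core assms(3) \<epsilon>])
        (use half elim r qp in \<open>auto simp: p_def u_def N_def c_def q_def\<close>)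
  qed
  then have "ereal \<kappa> \<le> liminf (\<lambda>n. ereal (measure_pmf.prob (srw_measure (G n))
      {x. cmod x > graph.srw_radius (G n) - \<epsilon>}))"
    by (intro Liminf_bounded) (auto elim: eventually_mono)
  moreover have "0 < ereal \<kappa>" using \<kappa> by simp
  ultimately show "liminf (\<lambda>n. ereal (measure_pmf.prob (srw_measure (G n))
           {x. cmod x >
               2 * sqrt (avg_degree (G n) - 1) /
                 (1 / (2 * real (card (edges (G n)))) *
                    (\<Sum>v\<in>verts (G n). (real (out_degree (G n) v))\<^sup>2)) - \<epsilon>})) > 0"
    by (rule order.strict_trans2[rotated])
qed

end
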